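(* Let $\Phi=(G,\varphi)$ be a $\mathbb{T}$-gain graph on a connected graph $G$ with $n$ vertices, and let $\{C_1,\dots,C_l\}$ be the collection of all fundamental cycles of $G$ with respect to a normal spanning tree $T$ of $G$. Then $$\mathcal{E}(\Phi)\geq 4+\frac{4}{n}\left\{\sum_{j=1}^{l}\Re\big(\varphi(C_j)\big)-1\right\},$$ and this inequality is sharp.
   Context: A $\mathbb{T}$-gain graph $\Phi=(G,\varphi)$ consists of a finite simple graph $G$ and a map $\varphi$ assigning to each orientation $\overrightarrow{e_{p,q}}$ of each edge $v_pv_q$ a value in $\mathbb{T}=\{z\in\mathbb{C}:|z|=1\}$, with $\varphi(\overrightarrow{e_{q,p}})=\varphi(\overrightarrow{e_{p,q}})^{-1}$. Its adjacency matrix $A(\Phi)$ is the Hermitian matrix whose $(p,q)$ entry is $\varphi(\overrightarrow{e_{p,q}})$ if $v_p\sim v_q$ and $0$ otherwise; $\mathcal{E}(\Phi)$ is the sum of absolute values of its eigenvalues. A normal spanning tree is a rooted spanning tree $T$ such that the two ends of every edge of $G$ are comparable in the tree order. For each edge $e\notin E(T)$, the unique cycle in $T+e$ is a fundamental cycle. The gain of an oriented cycle is the product of the gains of its oriented edges; both orientations have gains with the same real part, denoted $\Re(\varphi(C))$. *)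

theory Defs
  imports
    "Graph_Theory.Graph_Theory"
    "Jordan_Normal_Form.Char_Poly"
begin

text \<open>
  A finite simple graph is a \<^locale>\<open>pair_graph\<close>: a finite loop-free symmetric digraph
  whose arcs are ordered pairs of vertices. An undirected edge \<open>uv\<close> corresponds to the two arcs
  \<open>(u, v)\<close> and \<open>(v, u)\<close>, its two orientations.
\<close>

definition gain_graph :: "'a pair_pre_digraph \<Rightarrow> ('a \<times> 'a \<Rightarrow> complex) \<Rightarrow> bool" where
  "gain_graph G \<phi> \<longleftrightarrow> pair_graph G \<and>
     (\<forall>(u, v) \<in> parcs G. cmod (\<phi> (u, v)) = 1 \<and> \<phi> (v, u) = inverse (\<phi> (u, v)))"

text \<open>The list \<open>vs\<close> enumerates the vertices and so fixes the order of the rows and columns.\<close>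

definition gain_adj_mat ::
  "'a pair_pre_digraph \<Rightarrow> ('a \<times> 'a \<Rightarrow> complex) \<Rightarrow> 'a list \<Rightarrow> complex mat" where
  "gain_adj_mat G \<phi> vs = mat (length vs) (length vs)
     (\<lambda>(p, q). if (vs ! p, vs ! q) \<in> parcs G then \<phi> (vs ! p, vs ! q) else 0)"

text \<open>Eigenvalues are counted with algebraic multiplicity.\<close>

definition gain_energy ::
  "'a pair_pre_digraph \<Rightarrow> ('a \<times> 'a \<Rightarrow> complex) \<Rightarrow> 'a list \<Rightarrow> real" where
  "gain_energy G \<phi> vs = (\<Sum>z \<in># proots (char_poly (gain_adj_mat G \<phi> vs)). cmod z)"

text \<open>
  An oriented cycle is given by its list of consecutive arcs. In a symmetric digraph
  \<^const>\<open>pre_digraph.cycle\<close> also admits the closed walks \<open>(u, v), (v, u)\<close>, which are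
  not cycles of the undirected graph; they are excluded by the length condition. For the same
  reason the library's \<^const>\<open>Digraph_Component.tree\<close> does not describe undirected trees.
\<close>

definition oriented_cycle :: "'a pair_pre_digraph \<Rightarrow> ('a \<times> 'a) list \<Rightarrow> bool" where
  "oriented_cycle G p \<longleftrightarrow> pre_digraph.cycle (with_proj G) p \<and> 3 \<le> length p"

definition undirected_edges :: "('a \<times> 'a) list \<Rightarrow> 'a set set" where
  "undirected_edges p = (\<lambda>(u, v). {u, v}) ` set p"

text \<open>Unoriented cycles are represented by their sets of undirected edges.\<close>

definition graph_cycle :: "'a pair_pre_digraph \<Rightarrow> 'a set set \<Rightarrow> bool" where
  "graph_cycle G C \<longleftrightarrow> (\<exists>p. oriented_cycle G p \<and> undirected_edges p = C)"

definition undirected_spanning_tree :: "'a pair_pre_digraph \<Rightarrow> 'a pair_pre_digraph \<Rightarrow> bool" where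
  "undirected_spanning_tree T G \<longleftrightarrow>
     pair_graph T \<and> spanning (with_proj T) (with_proj G) \<and>
     Digraph_Component.connected (with_proj T) \<and> (\<nexists>C. graph_cycle T C)"

text \<open>The tree order: \<open>u\<close> is below \<open>v\<close> iff \<open>u\<close> lies on the path in \<open>T\<close> from the root \<open>r\<close> to \<open>v\<close>.\<close>

definition tree_le :: "'a pair_pre_digraph \<Rightarrow> 'a \<Rightarrow> 'a \<Rightarrow> 'a \<Rightarrow> bool" where
  "tree_le T r u v \<longleftrightarrow>
     (\<exists>p. pre_digraph.apath (with_proj T) r p v \<and>
          u \<in> set (pre_digraph.awalk_verts (with_proj T) r p))"

definition normal_spanning_tree ::
  "'a pair_pre_digraph \<Rightarrow> 'a \<Rightarrow> 'a pair_pre_digraph \<Rightarrow> bool" where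
  "normal_spanning_tree T r G \<longleftrightarrow>
     undirected_spanning_tree T G \<and> r \<in> pverts T \<and>
     (\<forall>(u, v) \<in> parcs G. tree_le T r u v \<or> tree_le T r v u)"

definition add_edge :: "'a pair_pre_digraph \<Rightarrow> 'a \<times> 'a \<Rightarrow> 'a pair_pre_digraph" where
  "add_edge T e = T\<lparr> parcs := parcs T \<union> {e, prod.swap e} \<rparr>"

definition fundamental_cycle :: "'a pair_pre_digraph \<Rightarrow> 'a \<times> 'a \<Rightarrow> 'a set set" where
  "fundamental_cycle T e = (THE C. graph_cycle (add_edge T e) C)"

definition fundamental_cycles ::
  "'a pair_pre_digraph \<Rightarrow> 'a pair_pre_digraph \<Rightarrow> 'a set set set" where
  "fundamental_cycles G T = fundamental_cycle T ` (parcs G - parcs T)"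

definition oriented_gain :: "('a \<times> 'a \<Rightarrow> complex) \<Rightarrow> ('a \<times> 'a) list \<Rightarrow> complex" where
  "oriented_gain \<phi> p = prod_list (map \<phi> p)"

text \<open>
  The choice of the arc list tracing \<open>C\<close> is immaterial: changing the starting vertex permutes the
  factors of the gain, and reversing the orientation inverts it, hence conjugates it because it
  has modulus 1.
\<close>

definition Re_cycle_gain ::
  "'a pair_pre_digraph \<Rightarrow> ('a \<times> 'a \<Rightarrow> complex) \<Rightarrow> 'a set set \<Rightarrow> real" where
  "Re_cycle_gain G \<phi> C =
     Re (oriented_gain \<phi> (SOME p. oriented_cycle G p \<and> undirected_edges p = C))"

end

theory Submission
  imports Defs "Jordan_Normal_Form.Schur_Decomposition"
begin

text \<open>
  Write \<open>n\<close> for the number of vertices and choose unimodular numbers \<open>\<theta> v\<close> with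
  \<open>\<theta> v = \<theta> u * \<phi> (u, v)\<close> along the arcs of \<open>T\<close>; this is possible because closed walks in \<open>T\<close>
  have gain 1. The switched gains \<open>\<theta> u * \<phi> (u, v) / \<theta> v\<close> are 1 on \<open>T\<close>, and on an arc outside \<open>T\<close>
  they equal the gain of its fundamental cycle
  up to conjugation. Hence, for the vector \<open>x\<close> with entries
  \<open>cnj (\<theta> v)\<close>, the quadratic form of the adjacency matrix at \<open>x\<close> is \<open>2 (n - 1 + S)\<close>, where \<open>S\<close> is
  the sum of the real parts of the gains of the fundamental cycles, and the largest eigenvalue
  is at least \<open>2 (n - 1 + S) / n\<close>. As the trace vanishes, the energy is at least twice the
  largest eigenvalue. Equality holds for complete graphs with
  all gains 1, where \<open>T\<close> is a Hamiltonian path.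
\<close>

section \<open>The largest eigenvalue of a Hermitian matrix\<close>

definition sqnorm :: "complex vec \<Rightarrow> real" where
  "sqnorm v = (\<Sum>i<dim_vec v. (cmod (v $ i))\<^sup>2)"

lemma cscalar_prod_self: "v \<bullet>c v = of_real (sqnorm v)"
  by (simp add: sqnorm_def scalar_prod_def complex_norm_square atLeast0LessThan del: of_real_power)

lemma sqnorm_nonneg: "0 \<le> sqnorm v"
  by (simp add: sqnorm_def sum_nonneg)

lemma sqnorm_smult: "sqnorm (c \<cdot>\<^sub>v v) = (cmod c)\<^sup>2 * sqnorm v"
  by (simp add: sqnorm_def norm_mult power_mult_distrib sum_distrib_left)

lemma sqnorm_eq_0_iff:
  assumes "v \<in> carrier_vec n"
  shows "sqnorm v = 0 \<longleftrightarrow> v = 0\<^sub>v n"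
  using assms conjugate_square_eq_0_vec[OF assms] by (simp add: cscalar_prod_self)

text \<open>Every entry of \<open>B *\<^sub>v y\<close> is at most an absolute row sum of
  \<open>B\<close> times the norm of \<open>y\<close>.\<close>

lemma sqnorm_mult_mat_vec_bound:
  fixes B :: "complex mat"
  assumes B: "B \<in> carrier_mat n n"
  obtains C where "0 < C" and "\<And>y. y \<in> carrier_vec n \<Longrightarrow> sqnorm (B *\<^sub>v y) \<le> C * sqnorm y"
proof -
  define R where "R i = (\<Sum>j<n. cmod (B $$ (i, j)))" for i
  \<comment> \<open>The summand 1 makes the constant positive even for the zero matrix.\<close>
  define C where "C = 1 + (\<Sum>i<n. (R i)\<^sup>2)"
  have "0 < C" by (simp add: C_def add_pos_nonneg sum_nonneg)
  moreover have "sqnorm (B *\<^sub>v y) \<le> C * sqnorm y" if y: "y \<in> carrier_vec n" for y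
  proof -
    define s where "s = sqrt (sqnorm y)"
    have s: "s\<^sup>2 = sqnorm y" "0 \<le> s" by (simp_all add: s_def sqnorm_nonneg)
    have le: "cmod (y $ j) \<le> s" if "j < n" for j
    proof -
      have "(cmod (y $ j))\<^sup>2 \<le> s\<^sup>2"
        unfolding s sqnorm_def using y that by (intro member_le_sum) auto
      then show ?thesis using s(2) by (rule power2_le_imp_le)
    qed
    have "(cmod ((B *\<^sub>v y) $ i))\<^sup>2 \<le> (R i)\<^sup>2 * sqnorm y" if "i < n" for i
    proof -
      have "(B *\<^sub>v y) $ i = (\<Sum>j<n. B $$ (i, j) * y $ j)"
        using B y that by (simp add: scalar_prod_def atLeast0LessThan)
      then have "cmod ((B *\<^sub>v y) $ i) \<le> (\<Sum>j<n. cmod (B $$ (i, j)) * cmod (y $ j))"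
        by (metis (no_types, lifting) norm_mult norm_sum sum.cong)
      also have "\<dots> \<le> R i * s"
        unfolding R_def sum_distrib_right by (intro sum_mono mult_left_mono le) auto
      finally have "(cmod ((B *\<^sub>v y) $ i))\<^sup>2 \<le> (R i * s)\<^sup>2" by (intro power_mono) auto
      then show ?thesis by (simp add: power_mult_distrib s)
    qed
    then have "sqnorm (B *\<^sub>v y) \<le> (\<Sum>i<n. (R i)\<^sup>2 * sqnorm y)"
      unfolding sqnorm_def[of "B *\<^sub>v y"] using B by (auto intro!: sum_mono)
    also have "\<dots> \<le> C * sqnorm y"
      unfolding C_def by (simp add: sum_distrib_right sqnorm_nonneg distrib_right)
    finally show ?thesis .
  qed
  ultimately show thesis by (rule that)
qed

text \<open>A crude substitute for Cauchy-Schwarz, applied entry by entry; wherever it is used, any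
  finite constant will do.\<close>

lemma Re_cscalar_prod_le:
  assumes "v \<in> carrier_vec n" "w \<in> carrier_vec n"
  shows "Re (v \<bullet>c w) \<le> sqnorm v + sqnorm w"
proof -
  have "Re (a * cnj b) \<le> (cmod a)\<^sup>2 + (cmod b)\<^sup>2" for a b
  proof -
    have "Re (a * cnj b) \<le> cmod a * cmod b"
      using complex_Re_le_cmod[of "a * cnj b"] by (simp add: norm_mult)
    also have "\<dots> \<le> (cmod a)\<^sup>2 + (cmod b)\<^sup>2"
      using sum_squares_bound[of "cmod a" "cmod b"] zero_le_power2[of "cmod a"] zero_le_power2[of "cmod b"]
      by linarith
    finally show ?thesis .
  qed
  then have "(\<Sum>i<n. Re (v $ i * cnj (w $ i))) \<le> (\<Sum>i<n. (cmod (v $ i))\<^sup>2 + (cmod (w $ i))\<^sup>2)"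
    by (intro sum_mono)
  moreover have "Re (v \<bullet>c w) = (\<Sum>i<n. Re (v $ i * cnj (w $ i)))"
    using assms by (simp add: scalar_prod_def atLeast0LessThan)
  ultimately show ?thesis using assms by (simp add: sqnorm_def sum.distrib)
qed

definition hermitian :: "complex mat \<Rightarrow> bool" where
  "hermitian A \<longleftrightarrow> (\<forall>i<dim_row A. \<forall>j<dim_row A. A $$ (j, i) = cnj (A $$ (i, j)))"

lemma hermitian_cscalar_prod:
  assumes A: "A \<in> carrier_mat n n" "hermitian A"
    and x: "x \<in> carrier_vec n" and y: "y \<in> carrier_vec n"
  shows "(A *\<^sub>v x) \<bullet>c y = x \<bullet>c (A *\<^sub>v y)"
proof -
  have "(A *\<^sub>v x) \<bullet>c y = (\<Sum>i<n. \<Sum>j<n. A $$ (i, j) * x $ j * cnj (y $ i))"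
    using A x y by (simp add: scalar_prod_def atLeast0LessThan sum_distrib_right)
  also have "\<dots> = (\<Sum>j<n. \<Sum>i<n. x $ j * cnj (A $$ (j, i) * y $ i))"
  proof (subst sum.swap, intro sum.cong refl)
    fix i j assume "i \<in> {..<n}" "j \<in> {..<n}"
    then have "A $$ (i, j) = cnj (A $$ (j, i))"
      using A unfolding hermitian_def by blast
    then show "A $$ (i, j) * x $ j * cnj (y $ i) = x $ j * cnj (A $$ (j, i) * y $ i)" by simp
  qed
  also have "\<dots> = x \<bullet>c (A *\<^sub>v y)"
    using A x y by (simp add: scalar_prod_def atLeast0LessThan sum_distrib_left)
  finally show ?thesis .
qed

text \<open>With \<open>y = M x\<close>, nonnegativity of the form at \<open>x - t y\<close> for a small \<open>t > 0\<close> gives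
  \<open>t |y|\<^sup>2 \<le> \<langle>M x, x\<rangle>\<close>, and \<open>|x|\<close> is bounded by a multiple of \<open>|y|\<close>.\<close>
lemma positive_definite_if_nonsingular:
  assumes M: "M \<in> carrier_mat n n" "hermitian M" "det M \<noteq> 0"
    and psd: "\<And>x. x \<in> carrier_vec n \<Longrightarrow> 0 \<le> Re ((M *\<^sub>v x) \<bullet>c x)"
  obtains \<delta> where "0 < \<delta>" and "\<And>x. x \<in> carrier_vec n \<Longrightarrow> \<delta> * sqnorm x \<le> Re ((M *\<^sub>v x) \<bullet>c x)"
proof -
  obtain B where B: "B \<in> carrier_mat n n" "B * M = 1\<^sub>m n"
    using det_non_zero_imp_unit[OF M(1,3)] by (auto simp: Units_def ring_mat_def)
  obtain C where C: "0 < C" "\<And>y. y \<in> carrier_vec n \<Longrightarrow> sqnorm (M *\<^sub>v y) \<le> C * sqnorm y"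
    using sqnorm_mult_mat_vec_bound[OF M(1)] by blast
  obtain D where D: "0 < D" "\<And>y. y \<in> carrier_vec n \<Longrightarrow> sqnorm (B *\<^sub>v y) \<le> D * sqnorm y"
    using sqnorm_mult_mat_vec_bound[OF B(1)] by blast
  \<comment> \<open>With this \<open>t\<close> the quadratic term
    \<open>t\<^sup>2 * (C + 1) * sqnorm y\<close> equals \<open>t * sqnorm y\<close>, half of the
    linear term \<open>2 * t * sqnorm y\<close>.\<close>
  define t where "t = 1 / (C + 1)"
  have t: "0 < t" "t * (C + 1) = 1" using C(1) by (simp_all add: t_def)
  have "t / D * sqnorm x \<le> Re ((M *\<^sub>v x) \<bullet>c x)" if x: "x \<in> carrier_vec n" for x
  proof -
    define y where "y = M *\<^sub>v x"
    have y: "y \<in> carrier_vec n" using M(1) x by (simp add: y_def)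
    have My: "M *\<^sub>v y \<in> carrier_vec n" using M(1) y by simp
    let ?ty = "(- of_real t) \<cdot>\<^sub>v y"
    have ty: "?ty \<in> carrier_vec n" using y by simp
    have Mty: "M *\<^sub>v ?ty = (- of_real t) \<cdot>\<^sub>v (M *\<^sub>v y)"
      using M(1) y by (simp add: mult_mat_vec)
    have "M *\<^sub>v (x + ?ty) = y + (- of_real t) \<cdot>\<^sub>v (M *\<^sub>v y)"
      using M(1) x ty Mty by (simp add: mult_add_distrib_mat_vec y_def)
    then have "(M *\<^sub>v (x + ?ty)) \<bullet>c (x + ?ty) =
        y \<bullet>c x - of_real t * (y \<bullet>c y) - of_real t * ((M *\<^sub>v y) \<bullet>c x) + of_real (t\<^sup>2) * ((M *\<^sub>v y) \<bullet>c y)"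
      using x y My
      by (simp add: conjugate_add_vec[of _ n] conjugate_smult_vec add_scalar_prod_distrib[of _ n]
          scalar_prod_add_distrib[of _ n] power2_eq_square algebra_simps)
    \<comment> \<open>Hermitian symmetry makes the second cross term equal to the squared norm of
      \<open>y\<close>, so the two linear terms merge.\<close>
    moreover have "(M *\<^sub>v y) \<bullet>c x = y \<bullet>c y"
      using hermitian_cscalar_prod[OF M(1,2) y x] by (simp add: y_def)
    ultimately have eq: "(M *\<^sub>v (x + ?ty)) \<bullet>c (x + ?ty) =
        y \<bullet>c x - 2 * of_real t * of_real (sqnorm y) + of_real (t\<^sup>2) * ((M *\<^sub>v y) \<bullet>c y)"
      by (simp add: cscalar_prod_self)
    have "0 \<le> Re ((M *\<^sub>v (x + ?ty)) \<bullet>c (x + ?ty))"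
      using psd x ty by simp
    also have "\<dots> = Re (y \<bullet>c x) - 2 * t * sqnorm y + t\<^sup>2 * Re ((M *\<^sub>v y) \<bullet>c y)"
      unfolding eq by simp
    also have "Re ((M *\<^sub>v y) \<bullet>c y) \<le> (C + 1) * sqnorm y"
      using Re_cscalar_prod_le[OF My y] C(2)[OF y] by (simp add: algebra_simps)
    then have "t\<^sup>2 * Re ((M *\<^sub>v y) \<bullet>c y) \<le> t\<^sup>2 * ((C + 1) * sqnorm y)"
      by (intro mult_left_mono) auto
    also have "t\<^sup>2 * ((C + 1) * sqnorm y) = t * (t * (C + 1)) * sqnorm y"
      by (simp add: power2_eq_square)
    also have "\<dots> = t * sqnorm y" by (simp only: t mult_1_right)
    finally have "t * sqnorm y \<le> Re (y \<bullet>c x)" by linarith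
    \<comment> \<open>Invertibility enters here: \<open>x\<close> is recovered from
      \<open>y\<close>, so a bound in terms of \<open>y\<close> becomes one in terms of
      \<open>x\<close>.\<close>
    moreover have "x = B *\<^sub>v y"
      using B M(1) x by (simp add: y_def flip: assoc_mult_mat_vec)
    then have "sqnorm x \<le> D * sqnorm y" using D(2)[OF y] by simp
    then have "t / D * sqnorm x \<le> t * sqnorm y"
      using D(1) t(1) by (simp add: field_simps)
    ultimately show ?thesis by (simp add: y_def)
  qed
  then show thesis using t(1) D(1) by (intro that[of "t / D"]) auto
qed

text \<open>The shifted matrix is the negative of \<open>char_matrix A k\<close>, and a sign does
  not affect whether the determinant vanishes.\<close>

lemma eigenvalue_iff_det_shift:
  assumes "A \<in> carrier_mat n n"
  shows "eigenvalue A k \<longleftrightarrow> det (k \<cdot>\<^sub>m 1\<^sub>m n - A) = (0 :: complex)"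
proof -
  have c: "char_matrix A k \<in> carrier_mat n n" using assms by simp
  have "k \<cdot>\<^sub>m 1\<^sub>m n - A = - char_matrix A k"
    using assms by (auto simp: char_matrix_def)
  then show ?thesis by (simp only: eigenvalue_det[OF assms] det_0_negate[OF c])
qed

text \<open>If the supremum \<open>\<mu>\<close> of the Rayleigh quotient were not an eigenvalue, the form of
  \<open>\<mu> I - A\<close> would be bounded away from 0 on the unit sphere.\<close>
lemma hermitian_max_eigenvalue:
  assumes A: "A \<in> carrier_mat n n" "hermitian A" and n: "0 < n"
  obtains \<mu> :: real where "eigenvalue A (of_real \<mu>)"
    and "\<And>x. x \<in> carrier_vec n \<Longrightarrow> Re ((A *\<^sub>v x) \<bullet>c x) \<le> \<mu> * sqnorm x"
proof -
  define S where "S = {Re ((A *\<^sub>v x) \<bullet>c x) | x. x \<in> carrier_vec n \<and> sqnorm x = 1}"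
  define \<mu> where "\<mu> = Sup S"
  obtain C where C: "0 < C" "\<And>y. y \<in> carrier_vec n \<Longrightarrow> sqnorm (A *\<^sub>v y) \<le> C * sqnorm y"
    using sqnorm_mult_mat_vec_bound[OF A(1)] by blast
  have "Re ((A *\<^sub>v x) \<bullet>c x) \<le> C + 1" if "x \<in> carrier_vec n" "sqnorm x = 1" for x
    using Re_cscalar_prod_le[of "A *\<^sub>v x" n x] C(2)[of x] A(1) that by simp
  then have bdd: "bdd_above S" unfolding S_def by (intro bdd_aboveI[of _ "C + 1"]) auto
  \<comment> \<open>A unit vector shows that \<open>S\<close> is nonempty, so that with boundedness
    \<open>Sup S\<close> is a genuine supremum.\<close>
  have "sqnorm (unit_vec n 0) = (\<Sum>i<n. if i = 0 then 1 else 0)"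
    unfolding sqnorm_def by (intro sum.cong) (auto simp: unit_vec_def)
  then have unit: "sqnorm (unit_vec n 0) = 1" using n by simp
  then have ne: "S \<noteq> {}" unfolding S_def using unit_vec_carrier by blast
  \<comment> \<open>Homogeneity of degree 2 carries a bound from the unit sphere to all
    vectors.\<close>
  have scale: "Re ((A *\<^sub>v x) \<bullet>c x) \<le> c * sqnorm x"
    if x: "x \<in> carrier_vec n" and c: "\<And>s. s \<in> S \<Longrightarrow> s \<le> c" for x c
  proof (cases "sqnorm x = 0")
    case True
    then have "x = 0\<^sub>v n" using sqnorm_eq_0_iff[OF x] by simp
    then show ?thesis using A True by simp
  next
    case False
    define r where "r = 1 / sqrt (sqnorm x)"
    have r: "r\<^sup>2 * sqnorm x = 1" "0 < r"
      using False sqnorm_nonneg[of x] by (simp_all add: r_def power_divide)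
    let ?y = "of_real r \<cdot>\<^sub>v x"
    have "Re ((A *\<^sub>v ?y) \<bullet>c ?y) \<in> S"
      unfolding S_def using x r by (intro CollectI exI[of _ ?y]) (simp add: sqnorm_smult)
    then have "Re ((A *\<^sub>v ?y) \<bullet>c ?y) \<le> c" by (rule c)
    moreover have "(A *\<^sub>v ?y) \<bullet>c ?y = of_real (r\<^sup>2) * ((A *\<^sub>v x) \<bullet>c x)"
      using x A(1) by (simp add: mult_mat_vec conjugate_smult_vec power2_eq_square)
    ultimately have "r\<^sup>2 * Re ((A *\<^sub>v x) \<bullet>c x) \<le> c" by (simp del: of_real_power)
    also have "c = r\<^sup>2 * (c * sqnorm x)" using r(1) by (metis mult.left_commute mult.right_neutral)
    finally show ?thesis using r(2) by (simp only: mult_le_cancel_left_pos zero_less_power)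
  qed
  have le: "Re ((A *\<^sub>v x) \<bullet>c x) \<le> \<mu> * sqnorm x" if "x \<in> carrier_vec n" for x
    by (rule scale[OF that]) (simp add: \<mu>_def cSup_upper bdd)
  moreover have "eigenvalue A (of_real \<mu>)"
  proof (rule ccontr)
    define M where "M = of_real \<mu> \<cdot>\<^sub>m 1\<^sub>m n - A"
    assume "\<not> eigenvalue A (of_real \<mu>)"
    then have "det M \<noteq> 0" using eigenvalue_iff_det_shift[OF A(1)] by (simp add: M_def)
    moreover have M: "M \<in> carrier_mat n n" unfolding M_def using A(1) by (rule minus_carrier_mat)
    moreover have hM: "hermitian M"
      unfolding hermitian_def
    proof (intro allI impI)
      fix i j assume "i < dim_row M" "j < dim_row M"
      then have ij: "i < n" "j < n" using M by simp_all
      have "A $$ (j, i) = cnj (A $$ (i, j))"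
        using A(2) carrier_matD[OF A(1)] ij unfolding hermitian_def by blast
      moreover have "M $$ (j, i) = (if i = j then of_real \<mu> else 0) - A $$ (j, i)"
        "M $$ (i, j) = (if i = j then of_real \<mu> else 0) - A $$ (i, j)"
        using A(1) ij by (simp_all add: M_def)
      ultimately show "M $$ (j, i) = cnj (M $$ (i, j))" by (simp only:) simp
    qed
    moreover have Mx: "Re ((M *\<^sub>v x) \<bullet>c x) = \<mu> * sqnorm x - Re ((A *\<^sub>v x) \<bullet>c x)"
      if x: "x \<in> carrier_vec n" for x
    proof -
      have "(of_real \<mu> \<cdot>\<^sub>m 1\<^sub>m n) *\<^sub>v x = of_real \<mu> \<cdot>\<^sub>v x"
        using x by (intro eq_vecI) auto
      then have "M *\<^sub>v x = of_real \<mu> \<cdot>\<^sub>v x - A *\<^sub>v x"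
        using A(1) x
        by (simp add: M_def minus_mult_distrib_mat_vec[of _ n n])
      then show ?thesis using A x
        by (simp add: minus_scalar_prod_distrib[of _ n] cscalar_prod_self)
    qed
    ultimately obtain \<delta> where \<delta>: "0 < \<delta>"
      "\<And>x. x \<in> carrier_vec n \<Longrightarrow> \<delta> * sqnorm x \<le> Re ((M *\<^sub>v x) \<bullet>c x)"
      using positive_definite_if_nonsingular[OF M hM] le by (metis (no_types) diff_ge_0_iff_ge)
    \<comment> \<open>On the unit sphere the form of \<open>A\<close> stays \<open>\<delta>\<close>
      below \<open>\<mu>\<close>, although \<open>\<mu>\<close> is its least upper bound
      there.\<close>
    have "s \<le> \<mu> - \<delta>" if s: "s \<in> S" for s
    proof -
      obtain x where x: "x \<in> carrier_vec n" "sqnorm x = 1" "s = Re ((A *\<^sub>v x) \<bullet>c x)"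
        using s unfolding S_def by blast
      then show ?thesis using \<delta>(2)[of x] Mx[of x] by simp
    qed
    then have "Sup S \<le> \<mu> - \<delta>" by (rule cSup_least[OF ne])
    then show False using \<delta>(1) by (simp add: \<mu>_def)
  qed
  ultimately show thesis by (rule that[rotated])
qed

text \<open>Schur decomposition gives \<open>A = P * B * Q\<close> with the roots on the diagonal of
  \<open>B\<close>. The trace of \<open>W * Q\<close> equals that of \<open>Q * W\<close>, so
  \<open>A\<close> and \<open>B\<close> have the same trace.\<close>

lemma sum_proots_char_poly:
  fixes A :: "complex mat"
  assumes A: "A \<in> carrier_mat n n"
  shows "\<Sum>\<^sub># (proots (char_poly A)) = (\<Sum>i<n. A $$ (i, i))"
proof -
  obtain es where es: "char_poly A = (\<Prod>e\<leftarrow>es. [:- e, 1:])" "length es = n"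
    using char_poly_factorized[OF A] by blast
  obtain B P Q where dec: "schur_decomposition A es = (B, P, Q)"
    by (cases "schur_decomposition A es")
  then have sim: "similar_mat_wit A B P Q" and diag: "diag_mat B = es"
    using schur_decomposition[OF A es(1)] by auto
  note w = similar_mat_witD2[OF A sim]
  define W where "W = P * B"
  have W: "W \<in> carrier_mat n n" using w(5,6) by (simp add: W_def)
  have "(\<Sum>i<n. A $$ (i, i)) = (\<Sum>i<n. (W * Q) $$ (i, i))"
    using w(3) by (simp add: W_def)
  also have "\<dots> = (\<Sum>i<n. \<Sum>j<n. W $$ (i, j) * Q $$ (j, i))"
    using W w(7) by (simp add: scalar_prod_def atLeast0LessThan)
  also have "\<dots> = (\<Sum>j<n. \<Sum>i<n. Q $$ (j, i) * W $$ (i, j))"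
    by (subst sum.swap) (simp add: mult.commute)
  also have "\<dots> = (\<Sum>j<n. (Q * W) $$ (j, j))"
    using W w(7) by (simp add: scalar_prod_def atLeast0LessThan)
  also have "Q * W = B"
    using w(2,5-7) by (simp add: W_def flip: assoc_mult_mat)
  also have "(\<Sum>j<n. B $$ (j, j)) = sum_list es"
    using w(5) by (simp add: diag[symmetric] diag_mat_def sum_list_sum_nth atLeast0LessThan)
  \<comment> \<open>The factorization into linear factors identifies the list with the multiset of
    roots, multiplicities included.\<close>
  also have "sum_list es = \<Sum>\<^sub># (proots (char_poly A))"
  proof -
    have "proots (\<Prod>e\<leftarrow>es. [:- e, 1:]) = mset es"
    proof (induction es)
      case (Cons a es)
      have "(\<Prod>e\<leftarrow>es. [:- e, 1:]) \<noteq> 0" by (auto simp: prod_list_zero_iff)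
      then show ?case using Cons by (simp add: proots_mult del: mult_pCons_left)
    qed simp
    then show ?thesis by (simp add: es(1) sum_mset_sum_list)
  qed
  finally show ?thesis by simp
qed

text \<open>With trace zero, the eigenvalues other than one copy of the largest,
  \<open>\<mu>\<close>, sum to \<open>-\<mu>\<close>. By the triangle inequality their moduli total
  at least that of \<open>\<mu>\<close>, so all moduli together total at least
  \<open>2 * \<mu>\<close>.\<close>

lemma sum_cmod_proots_ge:
  assumes A: "A \<in> carrier_mat n n" "hermitian A" and tr: "(\<Sum>i<n. A $$ (i, i)) = 0"
    and x: "x \<in> carrier_vec n"
  shows "2 * Re ((A *\<^sub>v x) \<bullet>c x) \<le> (\<Sum>z\<in>#proots (char_poly A). cmod z) * sqnorm x"
proof (cases "n = 0")
  case True
  then show ?thesis using x A by (simp add: sqnorm_def scalar_prod_def)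
next
  case False
  then obtain \<mu> where ev: "eigenvalue A (of_real \<mu>)"
    and le: "\<And>x. x \<in> carrier_vec n \<Longrightarrow> Re ((A *\<^sub>v x) \<bullet>c x) \<le> \<mu> * sqnorm x"
    using hermitian_max_eigenvalue[OF A] by blast
  let ?S = "proots (char_poly A)"
  have "char_poly A \<noteq> 0" using degree_monic_char_poly[OF A(1)] by force
  then have "of_real \<mu> \<in># ?S"
    using ev eigenvalue_root_char_poly[OF A(1)] by simp
  then obtain R where R: "?S = add_mset (of_real \<mu>) R" by (blast dest: multi_member_split)
  have "of_real \<mu> + \<Sum>\<^sub># R = 0" using sum_proots_char_poly[OF A(1)] tr R by simp
  then have "\<Sum>\<^sub># R = - of_real \<mu>" by (simp add: add_eq_0_iff)
  moreover have "cmod (\<Sum>\<^sub># R) \<le> (\<Sum>z\<in>#R. cmod z)"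
    by (induction R) (auto intro: norm_triangle_le)
  ultimately have "2 * \<mu> \<le> (\<Sum>z\<in>#?S. cmod z)" using R by simp
  then have "2 * \<mu> * sqnorm x \<le> (\<Sum>z\<in>#?S. cmod z) * sqnorm x"
    by (intro mult_right_mono sqnorm_nonneg)
  then show ?thesis using le[OF x] by linarith
qed

section \<open>Walks and cycles\<close>

lemma pcas_append: "pcas u (p @ q) w \<longleftrightarrow> (\<exists>v. pcas u p v \<and> pcas v q w)"
  by (induction p arbitrary: u) auto

lemma pawalk_verts_eq: "pcas u p v \<Longrightarrow> pawalk_verts u p = u # map snd p"
  by (induction p arbitrary: u) auto

lemma pcas_fst_hd: "pcas u p v \<Longrightarrow> p \<noteq> [] \<Longrightarrow> fst (hd p) = u"
  by (cases p) auto

lemma pcas_snd_last: "pcas u p v \<Longrightarrow> p \<noteq> [] \<Longrightarrow> snd (last p) = v"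
  by (induction p arbitrary: u) auto

lemma pcas_nth_Suc: "pcas u p v \<Longrightarrow> Suc i < length p \<Longrightarrow> fst (p ! Suc i) = snd (p ! i)"
proof (induction p arbitrary: u i)
  case (Cons e p)
  then show ?case by (cases i; cases p) auto
qed simp

text \<open>Every inner visit of a walk is the head of one arc and the tail of the next; only the
  two ends are unbalanced. A closed walk therefore has equal multisets of heads and tails.\<close>

lemma pcas_mset_verts:
  "pcas u p v \<Longrightarrow> add_mset v (mset (map fst p)) = add_mset u (mset (map snd p))"
proof (induction p arbitrary: u)
  case (Cons e p)
  then have "add_mset v (mset (map fst p)) = add_mset (snd e) (mset (map snd p))" by simp
  then show ?case using Cons.prems by (simp add: add_mset_commute)
qed simp

lemma pcas_rev_path: "pcas u p v \<Longrightarrow> pcas v (rev_path p) u"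
  by (induction p arbitrary: u) (auto simp: pcas_append)

lemma set_rev_path: "set (rev_path p) = prod.swap ` set p"
  by (induction p) auto

text \<open>Reduces a cycle to conditions on its arc list, so that cycles move between graphs by
  comparing arc sets. The base vertex lies in \<open>G\<close> because it is the tail of the first
  arc.\<close>

lemma oriented_cycle_iff:
  assumes "pair_wf_digraph G"
  shows "oriented_cycle G p \<longleftrightarrow>
    (\<exists>u. pcas u p u) \<and> set p \<subseteq> parcs G \<and> distinct (map snd p) \<and> 3 \<le> length p" (is "?L \<longleftrightarrow> ?R")
proof
  assume ?L
  then show ?R
    unfolding oriented_cycle_def pre_digraph.cycle_def pre_digraph.awalk_def cas_with_proj_eq
      awalk_verts_with_proj_eq by (auto simp: pawalk_verts_eq)
next
  assume R: ?R
  then obtain u where u: "pcas u p u" by blast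
  have "p \<noteq> []" using R by auto
  then have "hd p \<in> parcs G" using R by (meson hd_in_set subsetD)
  then have "u \<in> pverts G"
    using pair_wf_digraph.arc_fst_in_verts[OF assms] pcas_fst_hd[OF u \<open>p \<noteq> []\<close>] by metis
  then show ?L
    unfolding oriented_cycle_def pre_digraph.cycle_def pre_digraph.awalk_def cas_with_proj_eq
      awalk_verts_with_proj_eq using R u \<open>p \<noteq> []\<close> by (auto simp: pawalk_verts_eq intro!: exI[of _ u])
qed

text \<open>In a long cycle the successor of \<open>(x, y)\<close> is the only arc leaving \<open>y\<close>; if it were
  \<open>(y, x)\<close>, its own successor would be \<open>(x, y)\<close> again.\<close>
lemma cycle_no_reversed_arc:
  assumes p: "pcas u p u" "distinct (map snd p)" "3 \<le> length p" and xy: "(x, y) \<in> set p"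
  shows "(y, x) \<notin> set p"
proof
  assume yx: "(y, x) \<in> set p"
  define n where "n = length p"
  have n: "3 \<le> n" using p by (simp add: n_def)
  have ne: "p \<noteq> []" using xy by auto
  \<comment> \<open>Distinct heads force distinct tails, so an arc of the cycle is determined by its
    tail.\<close>
  have "mset (map fst p) = mset (map snd p)" using pcas_mset_verts[OF p(1)] by simp
  then have dist: "distinct (map fst p)" using p(2) mset_eq_imp_distinct_iff by blast
  \<comment> \<open>The cyclic successor of an index, wrapping from the last arc to the
    first.\<close>
  define nxt where "nxt k = (if Suc k = n then 0 else Suc k)" for k
  have nxt: "nxt k < n" "fst (p ! nxt k) = snd (p ! k)" if "k < n" for k
  proof -
    show "nxt k < n" using that by (auto simp: nxt_def)
    show "fst (p ! nxt k) = snd (p ! k)"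
    proof (cases "Suc k = n")
      case True
      then have "k = length p - 1" by (simp add: n_def)
      then have "p ! k = last p" using ne by (simp add: last_conv_nth)
      then show ?thesis
        using True pcas_fst_hd[OF p(1) ne] pcas_snd_last[OF p(1) ne] ne by (simp add: nxt_def hd_conv_nth)
    next
      case False
      then show ?thesis using that pcas_nth_Suc[OF p(1)] by (simp add: nxt_def n_def)
    qed
  qed
  obtain i j where ij: "i < n" "p ! i = (x, y)" "j < n" "p ! j = (y, x)"
    using xy yx by (auto simp: in_set_conv_nth n_def)
  have inj: "k = l" if "k < n" "l < n" "fst (p ! k) = fst (p ! l)" for k l
    using dist that by (simp add: distinct_conv_nth n_def) blast
  have "nxt i = j" using nxt[OF ij(1)] ij by (intro inj) auto
  moreover have "nxt j = i" using nxt[OF ij(3)] ij by (intro inj) auto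
  \<comment> \<open>Two successor steps return to the same index only if the length is at most
    2.\<close>
  ultimately show False using n ij(1,3) by (auto simp: nxt_def split: if_splits)
qed

lemma oriented_cycle_no_reversed_arc:
  assumes "pair_wf_digraph G" "oriented_cycle G p" "(x, y) \<in> set p"
  shows "(y, x) \<notin> set p"
  using assms cycle_no_reversed_arc by (metis oriented_cycle_iff)

lemma oriented_cycle_distinct:
  assumes "pair_wf_digraph G" "oriented_cycle G p"
  shows "distinct p"
  using assms oriented_cycle_iff[OF assms(1)] by (auto simp: distinct_map)

lemma prod_list_rev_path:
  fixes g :: "'a \<times> 'a \<Rightarrow> complex"
  assumes "\<And>u v. (u, v) \<in> set p \<Longrightarrow> g (u, v) * g (v, u) = 1"
  shows "prod_list (map g p) * prod_list (map g (rev_path p)) = 1"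
  using assms
proof (induction p)
  case (Cons e p)
  have "g e * g (snd e, fst e) = 1" using Cons.prems[of "fst e" "snd e"] by simp
  moreover have "prod_list (map g p) * prod_list (map g (rev_path p)) = 1"
    using Cons by simp
  ultimately show ?case
    by (simp add: mult_ac) (metis mult.assoc mult.commute mult_1)
qed simp

text \<open>Strong induction on the length. A repeated head splits the walk into two shorter closed
  walks; without repetition, acyclicity leaves only the empty walk and an edge traversed back and
  forth.\<close>

lemma acyclic_closed_walk_gain:
  fixes g :: "'a \<times> 'a \<Rightarrow> complex"
  assumes T: "pair_graph T" "\<nexists>C. graph_cycle T C"
    and g: "\<And>u v. (u, v) \<in> parcs T \<Longrightarrow> g (u, v) * g (v, u) = 1"
    and p: "pcas u p u" "set p \<subseteq> parcs T"
  shows "prod_list (map g p) = 1"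
  using p
proof (induction "length p" arbitrary: u p rule: less_induct)
  case less
  interpret T: pair_graph T by fact
  show ?case
  proof (cases "distinct (map snd p)")
    case True
    have "\<not> oriented_cycle T p" using T(2) by (auto simp: graph_cycle_def)
    then have "length p < 3"
      using True less.prems by (auto simp: oriented_cycle_iff[OF T.pair_wf_digraph])
    then consider "p = []" | a where "p = [a]" | a b where "p = [a, b]"
      by (cases p; cases "tl p"; cases "tl (tl p)") auto
    then show ?thesis
    proof cases
      case 2
      then have "fst a = snd a" "a \<in> parcs T" using less.prems by auto
      then show ?thesis using T.pair_no_loops by blast
    next
      case 3
      then have "b = (snd a, fst a)" "a \<in> parcs T" using less.prems by (auto simp: prod_eq_iff)
      then show ?thesis using 3 g[of "fst a" "snd a"] by simp
    qed simp
  next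
    case False
    then obtain xs y ys zs where "map snd p = xs @ [y] @ ys @ [y] @ zs"
      using not_distinct_decomp by blast
    then obtain q e r e' s where dec: "p = q @ [e] @ r @ [e'] @ s" "snd e = y" "snd e' = y"
      by (auto simp: map_eq_append_conv map_eq_Cons_conv append_eq_map_conv Cons_eq_map_conv)
    \<comment> \<open>The segment between the two visits to \<open>y\<close> is cut out as one
      closed walk; the rest closes up because both \<open>e\<close> and \<open>e'\<close> end in
      \<open>y\<close>.\<close>
    have inner: "pcas y (r @ [e']) y" and outer: "pcas u (q @ [e] @ s) u"
      using less.prems(1) dec by (auto simp: pcas_append)
    have "prod_list (map g (r @ [e'])) = 1"
      using dec less.prems by (intro less.hyps[OF _ inner]) auto
    moreover have "prod_list (map g (q @ [e] @ s)) = 1"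
      using dec less.prems by (intro less.hyps[OF _ outer]) auto
    moreover have "prod_list (map g p) = prod_list (map g (r @ [e'])) * prod_list (map g (q @ [e] @ s))"
      by (simp add: dec(1) mult_ac)
    ultimately show ?thesis by simp
  qed
qed

text \<open>Connectedness speaks of the symmetric closure, which adds no reachability since the arcs
  of \<open>T\<close> are symmetric; a walk then shortens to a path.\<close>

lemma connected_pair_graph_walk:
  assumes "pair_graph T" "Digraph_Component.connected (with_proj T)" "u \<in> pverts T" "v \<in> pverts T"
  obtains p where "pcas u p v" "set p \<subseteq> parcs T" "distinct (u # map snd p)"
proof -
  interpret T: pair_graph T by fact
  have "u \<rightarrow>\<^sup>*\<^bsub>mk_symmetric T\<^esub> v"
    using assms(2-4) by (auto simp: connected_def strongly_connected_def)
  then have "u \<rightarrow>\<^sup>*\<^bsub>T\<^esub> v" using T.reachable_mk_symmetric_eq T.sym_arcs by blast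
  then obtain p where "T.apath u p v" using T.reachable_apath by blast
  then show thesis
    using pawalk_verts_eq[of u p v] by (intro that[of p]) (simp_all add: T.apath_def T.awalk_def)
qed

section \<open>Potentials and fundamental cycles\<close>

text \<open>Values need only be nonzero, not unimodular, because gains with the values 2 and 1/2
  also get potentials below.\<close>

definition potential :: "'a pair_pre_digraph \<Rightarrow> ('a \<times> 'a \<Rightarrow> complex) \<Rightarrow> ('a \<Rightarrow> complex) \<Rightarrow> bool" where
  "potential T g \<theta> \<longleftrightarrow> (\<forall>v\<in>pverts T. \<theta> v \<noteq> 0) \<and> (\<forall>(u, v)\<in>parcs T. \<theta> v = \<theta> u * g (u, v))"

definition switched :: "('a \<Rightarrow> complex) \<Rightarrow> ('a \<times> 'a \<Rightarrow> complex) \<Rightarrow> 'a \<times> 'a \<Rightarrow> complex" where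
  "switched \<theta> g a = \<theta> (fst a) * g a / \<theta> (snd a)"

text \<open>The potential at \<open>v\<close> is the gain of a chosen walk from a root to
  \<open>v\<close>. The conclusion on moduli is conditional so that the lemma also serves gains that
  are not unimodular.\<close>

lemma potential_exists:
  fixes g :: "'a \<times> 'a \<Rightarrow> complex"
  assumes T: "pair_graph T" "Digraph_Component.connected (with_proj T)" "\<nexists>C. graph_cycle T C"
    and g: "\<And>u v. (u, v) \<in> parcs T \<Longrightarrow> g (u, v) * g (v, u) = 1"
  obtains \<theta> where "potential T g \<theta>"
    and "(\<And>a. a \<in> parcs T \<Longrightarrow> cmod (g a) = 1) \<Longrightarrow> (\<And>v. v \<in> pverts T \<Longrightarrow> cmod (\<theta> v) = 1)"
proof -
  interpret T: pair_graph T by fact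
  obtain r where r: "r \<in> pverts T"
    using T(2) by (auto simp: connected_def strongly_connected_def)
  define P where "P v = (SOME p. pcas r p v \<and> set p \<subseteq> parcs T)" for v
  have P: "pcas r (P v) v" "set (P v) \<subseteq> parcs T" if v: "v \<in> pverts T" for v
  proof -
    obtain p where "pcas r p v" "set p \<subseteq> parcs T"
      by (rule connected_pair_graph_walk[OF T(1,2) r v])
    then have "\<exists>p. pcas r p v \<and> set p \<subseteq> parcs T" by blast
    then have "pcas r (P v) v \<and> set (P v) \<subseteq> parcs T" unfolding P_def by (rule someI_ex)
    then show "pcas r (P v) v" "set (P v) \<subseteq> parcs T" by auto
  qed
  define \<theta> where "\<theta> v = prod_list (map g (P v))" for v
  have inv: "\<theta> v * prod_list (map g (rev_path (P v))) = 1" if "v \<in> pverts T" for v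
    unfolding \<theta>_def using P(2)[OF that] g by (intro prod_list_rev_path) blast
  have "\<theta> v = \<theta> u * g (u, v)" if uv: "(u, v) \<in> parcs T" for u v
  proof -
    have V: "u \<in> pverts T" "v \<in> pverts T" using uv T.wellformed' by auto
    have "set (rev_path (P v)) \<subseteq> parcs T"
      using P(2)[OF V(2)] T.arcs_symmetric by (auto simp: set_rev_path)
    moreover have "pcas r (P u) u" "pcas u [(u, v)] v" "pcas v (rev_path (P v)) r"
      using P(1) V pcas_rev_path[OF P(1)[OF V(2)]] by auto
    \<comment> \<open>Going out to \<open>u\<close>, across the arc and back from \<open>v\<close>
      is a closed walk in \<open>T\<close>, hence has gain 1.\<close>
    then have "pcas r (P u @ [(u, v)] @ rev_path (P v)) r"
      unfolding pcas_append by blast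
    ultimately have "prod_list (map g (P u @ [(u, v)] @ rev_path (P v))) = 1"
      using P(2) V uv by (intro acyclic_closed_walk_gain[OF T(1,3), of g r]) (auto simp: g)
    then have "\<theta> u * g (u, v) * prod_list (map g (rev_path (P v))) = 1"
      by (simp add: \<theta>_def mult.assoc)
    then show ?thesis using inv[OF V(2)]
      by (metis mult.assoc mult.commute mult.right_neutral)
  qed
  moreover have "\<theta> v \<noteq> 0" if "v \<in> pverts T" for v using inv[OF that] by auto
  ultimately have "potential T g \<theta>" by (auto simp: potential_def)
  moreover have "cmod (\<theta> v) = 1" if "\<And>a. a \<in> parcs T \<Longrightarrow> cmod (g a) = 1" "v \<in> pverts T" for v
  proof -
    have "cmod (prod_list (map g p)) = 1" if "set p \<subseteq> parcs T" for p
      using that \<open>\<And>a. a \<in> parcs T \<Longrightarrow> cmod (g a) = 1\<close> by (induction p) (auto simp: norm_mult)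
    then show ?thesis using P(2)[OF \<open>v \<in> pverts T\<close>] by (simp add: \<theta>_def)
  qed
  ultimately show thesis by (rule that)
qed

text \<open>The potentials of inner vertices telescope; in particular switching preserves the gain
  of a closed walk.\<close>

lemma prod_list_switched:
  assumes "pcas u p v" "\<theta> u \<noteq> 0" "\<And>a. a \<in> set p \<Longrightarrow> \<theta> (snd a) \<noteq> 0"
  shows "prod_list (map (switched \<theta> g) p) = \<theta> u * prod_list (map g p) / \<theta> v"
  using assms by (induction p arbitrary: u) (auto simp: switched_def)

lemma switched_tree_arc:
  assumes "potential T g \<theta>" "pair_wf_digraph T" "a \<in> parcs T"
  shows "switched \<theta> g a = 1"
proof -
  have "snd a \<in> pverts T" using assms(2,3) by (simp add: pair_wf_digraph.arc_snd_in_verts)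
  then show ?thesis using assms by (cases a) (auto simp: potential_def switched_def)
qed

section \<open>Cycles created by adding one edge to a tree\<close>

definition chord :: "'a pair_pre_digraph \<Rightarrow> 'a \<Rightarrow> 'a \<Rightarrow> bool" where
  "chord T a b \<longleftrightarrow> a \<in> pverts T \<and> b \<in> pverts T \<and> a \<noteq> b \<and> (a, b) \<notin> parcs T \<and> (b, a) \<notin> parcs T"

lemma add_edge_simps:
  "pverts (add_edge T (a, b)) = pverts T" "parcs (add_edge T (a, b)) = parcs T \<union> {(a, b), (b, a)}"
  by (simp_all add: add_edge_def)

lemma add_edge_wf:
  assumes "pair_wf_digraph T" "chord T a b"
  shows "pair_wf_digraph (add_edge T (a, b))"
  using assms pair_wf_digraph.arc_fst_in_verts pair_wf_digraph.arc_snd_in_verts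
  by unfold_locales (fastforce simp: add_edge_simps chord_def)+

lemma cycle_contains_chord:
  assumes T: "pair_wf_digraph T" "\<nexists>C. graph_cycle T C" and c: "chord T a b"
    and p: "oriented_cycle (add_edge T (a, b)) p"
  shows "(a, b) \<in> set p \<or> (b, a) \<in> set p"
proof (rule ccontr)
  assume "\<not> ?thesis"
  then have "oriented_cycle T p"
    using p by (auto simp: oriented_cycle_iff[OF T(1)] oriented_cycle_iff[OF add_edge_wf[OF T(1) c]] add_edge_simps)
  then show False using T(2) by (auto simp: graph_cycle_def)
qed

text \<open>Switching preserves the gain of the cycle and turns every tree arc into a factor 1. The
  cycle traverses the new edge exactly once, in one of its two orientations, and that factor
  remains.\<close>

lemma chord_cycle_gain:
  assumes T: "pair_wf_digraph T" "\<nexists>C. graph_cycle T C" and c: "chord T a b"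
    and p: "oriented_cycle (add_edge T (a, b)) p" and \<theta>: "potential T g \<theta>"
  shows "prod_list (map g p) \<in> {switched \<theta> g (a, b), switched \<theta> g (b, a)}"
proof -
  let ?h = "switched \<theta> g"
  note wf = add_edge_wf[OF T(1) c]
  interpret T': pair_wf_digraph "add_edge T (a, b)" by (rule wf)
  obtain u where u: "pcas u p u" "set p \<subseteq> parcs T \<union> {(a, b), (b, a)}" "3 \<le> length p"
    using p by (auto simp: oriented_cycle_iff[OF wf] add_edge_simps)
  have verts: "fst x \<in> pverts T \<and> snd x \<in> pverts T" if "x \<in> set p" for x
    using u(2) that T'.arc_fst_in_verts[of x] T'.arc_snd_in_verts[of x] by (auto simp: add_edge_simps)
  have ne: "p \<noteq> []" using u(3) by auto
  have "u \<in> pverts T" using verts[of "hd p"] pcas_fst_hd[OF u(1) ne] ne by auto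
  then have "\<theta> u \<noteq> 0" using \<theta> by (simp add: potential_def)
  moreover have "\<theta> (snd x) \<noteq> 0" if "x \<in> set p" for x
    using verts[OF that] \<theta> by (simp add: potential_def)
  ultimately have "prod_list (map ?h p) = prod_list (map g p)"
    using prod_list_switched[OF u(1), of \<theta> g] by simp
  moreover have "prod_list (map ?h p) = prod ?h (set p)"
    using oriented_cycle_distinct[OF wf p] by (simp add: prod.distinct_set_conv_list)
  moreover have one: "?h x = 1" if "x \<in> set p" "x \<noteq> (a, b)" "x \<noteq> (b, a)" for x
    using switched_tree_arc[OF \<theta> T(1)] u(2) that by blast
  have "prod ?h (set p) = ?h (x, y)" if "(x, y) = (a, b) \<or> (x, y) = (b, a)" "(x, y) \<in> set p" for x y
  proof -
    have "(y, x) \<notin> set p" using oriented_cycle_no_reversed_arc[OF wf p that(2)] .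
    then have "prod ?h (set p - {(x, y)}) = 1"
      using that(1) by (intro prod.neutral ballI one) auto
    then show ?thesis using that(2) by (simp add: prod.remove[of _ "(x, y)"])
  qed
  ultimately show ?thesis using cycle_contains_chord[OF T c p] by auto
qed

text \<open>A gain which detects a single edge: since cycles do not traverse an edge twice, the edge lies
  on a cycle iff the gain of the cycle is not 1.\<close>
definition edge_gain :: "'a \<Rightarrow> 'a \<Rightarrow> 'a \<times> 'a \<Rightarrow> complex" where
  "edge_gain x y a = (if a = (x, y) then 2 else if a = (y, x) then 1 / 2 else 1)"

lemma edge_gain_inverse: "x \<noteq> y \<Longrightarrow> edge_gain x y (u, v) * edge_gain x y (v, u) = 1"
  by (auto simp: edge_gain_def)

lemma mem_undirected_edges_iff_gain:
  assumes G: "pair_wf_digraph G" "oriented_cycle G p" and xy: "x \<noteq> y"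
  shows "{x, y} \<in> undirected_edges p \<longleftrightarrow> prod_list (map (edge_gain x y) p) \<noteq> 1"
proof -
  have mem: "{x, y} \<in> undirected_edges p \<longleftrightarrow> (x, y) \<in> set p \<or> (y, x) \<in> set p"
    by (auto simp: undirected_edges_def doubleton_eq_iff)
  have eq: "prod_list (map (edge_gain x y) p) = prod (edge_gain x y) (set p)"
    using oriented_cycle_distinct[OF G] by (simp add: prod.distinct_set_conv_list)
  have one: "prod (edge_gain x y) (set p - {e}) = 1"
    if "\<And>a. a \<in> set p - {e} \<Longrightarrow> a \<noteq> (x, y) \<and> a \<noteq> (y, x)" for e
    using that by (intro prod.neutral) (auto simp: edge_gain_def)
  show ?thesis
  proof (cases "{x, y} \<in> undirected_edges p")
    case False
    then have "prod (edge_gain x y) (set p) = 1"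
      using mem by (intro prod.neutral) (auto simp: edge_gain_def)
    then show ?thesis using False eq by simp
  next
    case True
    then obtain e where e: "e \<in> set p" "e = (x, y) \<or> e = (y, x)" using mem by auto
    then have "prod (edge_gain x y) (set p) = edge_gain x y e"
      using oriented_cycle_no_reversed_arc[OF G] one[of e] by (subst prod.remove[of _ e]) auto
    then show ?thesis using e xy True eq by (auto simp: edge_gain_def)
  qed
qed

text \<open>Uniqueness of the fundamental cycle by gains: two cycles through the chord have equal or
  reciprocal gains, so the gain detecting an edge is 1 on both or on neither.\<close>

lemma chord_cycle_edges_subset:
  assumes T: "pair_graph T" "Digraph_Component.connected (with_proj T)" "\<nexists>C. graph_cycle T C"
    and c: "chord T a b"
    and p: "oriented_cycle (add_edge T (a, b)) p" and q: "oriented_cycle (add_edge T (a, b)) q"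
  shows "undirected_edges p \<subseteq> undirected_edges q"
proof
  interpret T: pair_graph T by fact
  note wf = add_edge_wf[OF T.pair_wf_digraph c]
  fix f assume f: "f \<in> undirected_edges p"
  then obtain x y where xy: "f = {x, y}" "(x, y) \<in> set p" by (auto simp: undirected_edges_def)
  \<comment> \<open>An arc from a vertex to itself would be its own reversal.\<close>
  have ne: "x \<noteq> y" using oriented_cycle_no_reversed_arc[OF wf p xy(2)] xy(2) by auto
  let ?g = "edge_gain x y"
  obtain \<theta> where \<theta>: "potential T ?g \<theta>"
    using potential_exists[OF T, of ?g] edge_gain_inverse[OF ne] by metis
  let ?c = "switched \<theta> ?g (a, b)" and ?d = "switched \<theta> ?g (b, a)"
  have "\<theta> a \<noteq> 0" "\<theta> b \<noteq> 0" using \<theta> c by (auto simp: potential_def chord_def)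
  then have "?c * ?d = ?g (a, b) * ?g (b, a)" by (simp add: switched_def)
  \<comment> \<open>The two possible cycle gains are reciprocal, so if one differs from 1, so does
    the other.\<close>
  then have cd: "?c * ?d = 1" using edge_gain_inverse[OF ne] by simp
  have "prod_list (map ?g p) \<noteq> 1"
    using mem_undirected_edges_iff_gain[OF wf p ne] f xy(1) by simp
  then have "?c \<noteq> 1 \<and> ?d \<noteq> 1"
    using chord_cycle_gain[OF T.pair_wf_digraph T(3) c p \<theta>] cd by (metis insertE mult_1 mult.right_neutral singletonD)
  then have "prod_list (map ?g q) \<noteq> 1"
    using chord_cycle_gain[OF T.pair_wf_digraph T(3) c q \<theta>] by (metis insertE singletonD)
  then show "f \<in> undirected_edges q"
    using mem_undirected_edges_iff_gain[OF wf q ne] xy(1) by simp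
qed

text \<open>The path in \<open>T\<close> from \<open>b\<close> to \<open>a\<close> is closed by the
  arc \<open>(a, b)\<close>. It has at least two arcs since a chord is not an arc of
  \<open>T\<close>, which gives the required cycle length 3.\<close>

lemma chord_cycle_exists:
  assumes T: "pair_graph T" "Digraph_Component.connected (with_proj T)" and c: "chord T a b"
  obtains p where "oriented_cycle (add_edge T (a, b)) p"
proof -
  interpret T: pair_graph T by fact
  note wf = add_edge_wf[OF T.pair_wf_digraph c]
  obtain q where q: "pcas b q a" "set q \<subseteq> parcs T" "distinct (b # map snd q)"
    using connected_pair_graph_walk[OF T, of b a] c by (auto simp: chord_def)
  have "2 \<le> length q"
  proof (rule ccontr)
    assume "\<not> ?thesis"
    then consider "q = []" | e where "q = [e]" by (cases q; cases "tl q") auto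
    then show False
    proof cases
      case 2
      then have "e = (b, a)" using q by (auto simp: prod_eq_iff)
      then show ?thesis using 2 q c by (auto simp: chord_def)
    qed (use q c in \<open>auto simp: chord_def\<close>)
  qed
  then have "oriented_cycle (add_edge T (a, b)) ((a, b) # q)"
    using q by (auto simp: oriented_cycle_iff[OF wf] add_edge_simps)
  then show thesis by (rule that)
qed

text \<open>Justifies the definite description: inclusion of edge sets, used in both directions,
  gives uniqueness.\<close>

lemma fundamental_cycle_eq:
  assumes T: "pair_graph T" "Digraph_Component.connected (with_proj T)" "\<nexists>C. graph_cycle T C"
    and c: "chord T a b" and p: "oriented_cycle (add_edge T (a, b)) p"
  shows "fundamental_cycle T (a, b) = undirected_edges p"
  unfolding fundamental_cycle_def
proof (rule the_equality)
  show "graph_cycle (add_edge T (a, b)) (undirected_edges p)"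
    using p by (auto simp: graph_cycle_def)
next
  fix C assume "graph_cycle (add_edge T (a, b)) C"
  then obtain q where "oriented_cycle (add_edge T (a, b)) q" "undirected_edges q = C"
    by (auto simp: graph_cycle_def)
  then show "C = undirected_edges p"
    using chord_cycle_edges_subset[OF T c] p by blast
qed

text \<open>Every vertex other than the root has a neighbour closer to the root; these parent edges,
  taken in both orientations, are pairwise different arcs.\<close>

lemma card_parcs_connected_ge:
  assumes T: "pair_graph T" "Digraph_Component.connected (with_proj T)"
  shows "2 * (card (pverts T) - 1) \<le> card (parcs T)"
proof -
  interpret T: pair_graph T by fact
  obtain r where r: "r \<in> pverts T"
    using T(2) by (auto simp: connected_def strongly_connected_def)
  \<comment> \<open>The distance from the root; deleting the last arc of a shortest walk yields a
    parent.\<close>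
  define d where "d v = (LEAST k. \<exists>p. pcas r p v \<and> set p \<subseteq> parcs T \<and> length p = k)" for v
  have "\<exists>u. (u, v) \<in> parcs T \<and> d u < d v" if v: "v \<in> pverts T - {r}" for v
  proof -
    have "v \<in> pverts T" using v by simp
    then obtain p0 where "pcas r p0 v" "set p0 \<subseteq> parcs T"
      by (rule connected_pair_graph_walk[OF T r])
    then have "\<exists>k p. pcas r p v \<and> set p \<subseteq> parcs T \<and> length p = k" by blast
    then have "\<exists>p. pcas r p v \<and> set p \<subseteq> parcs T \<and> length p = d v"
      unfolding d_def by (rule LeastI_ex)
    then obtain p where p: "pcas r p v" "set p \<subseteq> parcs T" "length p = d v" by blast
    have "p \<noteq> []" using p v by auto
    then obtain q e where qe: "p = q @ [e]" by (metis rev_exhaust)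
    then have e: "snd e = v" "pcas r q (fst e)" using p(1) unfolding qe pcas_append by auto
    have "d (fst e) \<le> length q" unfolding d_def using e(2) p(2) qe by (intro Least_le) auto
    then have "d (fst e) < d v" using p(3) qe by simp
    moreover have "(fst e, v) \<in> parcs T" using p(2) qe e(1) by (cases e) simp
    ultimately show ?thesis by blast
  qed
  then obtain par where par: "(par v, v) \<in> parcs T" "d (par v) < d v" if "v \<in> pverts T - {r}" for v
    by metis
  let ?A = "(\<lambda>v. (par v, v)) ` (pverts T - {r})" and ?B = "(\<lambda>v. (v, par v)) ` (pverts T - {r})"
  \<comment> \<open>A common arc would make two vertices parents of each other, each strictly closer
    to the root than the other.\<close>
  have "?A \<inter> ?B = {}"
  proof (rule equals0I)
    fix x assume "x \<in> ?A \<inter> ?B"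
    then obtain v w where vw: "v \<in> pverts T - {r}" "w \<in> pverts T - {r}" "par v = w" "v = par w"
      by blast
    then show False using par(2)[OF vw(1)] par(2)[OF vw(2)] by simp
  qed
  moreover have "card ?A = card (pverts T) - 1" "card ?B = card (pverts T) - 1"
    using r by (simp_all add: card_image inj_on_def)
  ultimately have "card (?A \<union> ?B) = 2 * (card (pverts T) - 1)"
    by (subst card_Un_disjoint) auto
  moreover have "card (?A \<union> ?B) \<le> card (parcs T)"
    using par(1) T.arcs_symmetric by (intro card_mono) auto
  ultimately show ?thesis by simp
qed

section \<open>Gain graphs with a spanning tree\<close>

lemma inverse_unit_cnj: "cmod z = 1 \<Longrightarrow> inverse z = cnj z"
  by (intro inverse_unique) (simp add: complex_norm_square[symmetric])

locale gain_graph_spanning_tree =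
  fixes G :: "'a pair_pre_digraph" and \<phi> :: "'a \<times> 'a \<Rightarrow> complex" and T :: "'a pair_pre_digraph"
  assumes gain: "gain_graph G \<phi>" and tree: "undirected_spanning_tree T G"
begin

lemma pair_graph_G: "pair_graph G"
  using gain by (simp add: gain_graph_def)

sublocale G: pair_graph G by (rule pair_graph_G)

lemma pair_graph_T: "pair_graph T" and connected_T: "Digraph_Component.connected (with_proj T)"
  and acyclic_T: "\<nexists>C. graph_cycle T C" and pverts_T: "pverts T = pverts G" and parcs_T: "parcs T \<subseteq> parcs G"
  using tree by (auto simp: undirected_spanning_tree_def spanning_def subgraph_def)

sublocale T: pair_graph T by (rule pair_graph_T)

lemma cmod_gain: "a \<in> parcs G \<Longrightarrow> cmod (\<phi> a) = 1"
  using gain by (cases a) (auto simp: gain_graph_def)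

lemma gain_swap: "(u, v) \<in> parcs G \<Longrightarrow> \<phi> (v, u) = cnj (\<phi> (u, v))"
  using gain by (auto simp: gain_graph_def inverse_unit_cnj)

lemma gain_mult_swap: "(u, v) \<in> parcs G \<Longrightarrow> \<phi> (u, v) * \<phi> (v, u) = 1"
  using cmod_gain[of "(u, v)"] gain_swap[of u v] by (simp add: complex_norm_square[symmetric])

lemma chordI: "(a, b) \<in> parcs G - parcs T \<Longrightarrow> chord T a b"
  using G.wellformed' G.no_loops' T.arcs_symmetric by (auto simp: chord_def pverts_T)

text \<open>The arc list chosen in \<open>Re_cycle_gain\<close> is known only by its edges, but it
  is still a cycle of \<open>T\<close> plus the chord. Its gain is thus the switched gain of one
  orientation of the chord, and both orientations have the same real part.\<close>

lemma Re_cycle_gain_fundamental: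
  assumes e: "(a, b) \<in> parcs G - parcs T" and \<theta>: "potential T \<phi> \<theta>"
    and unit: "\<And>v. v \<in> pverts T \<Longrightarrow> cmod (\<theta> v) = 1"
  shows "Re_cycle_gain G \<phi> (fundamental_cycle T (a, b)) = Re (switched \<theta> \<phi> (a, b))"
proof -
  note c = chordI[OF e]
  note wf = add_edge_wf[OF T.pair_wf_digraph c]
  obtain p0 where p0: "oriented_cycle (add_edge T (a, b)) p0"
    using chord_cycle_exists[OF pair_graph_T connected_T c] by blast
  then have C: "fundamental_cycle T (a, b) = undirected_edges p0"
    using fundamental_cycle_eq[OF pair_graph_T connected_T acyclic_T c] by blast
  have sub: "parcs (add_edge T (a, b)) \<subseteq> parcs G"
    using parcs_T e G.arcs_symmetric by (auto simp: add_edge_simps)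
  define p where "p = (SOME p. oriented_cycle G p \<and> undirected_edges p = undirected_edges p0)"
  have "oriented_cycle G p0"
    using p0 sub unfolding oriented_cycle_iff[OF G.pair_wf_digraph] oriented_cycle_iff[OF wf] by blast
  then have p: "oriented_cycle G p" "undirected_edges p = undirected_edges p0"
    unfolding p_def by (metis (mono_tags, lifting) someI_ex)+
  \<comment> \<open>Equal edge sets fix each arc only up to reversal, which is enough because the
    arcs of the enlarged tree are symmetric.\<close>
  have "set p \<subseteq> parcs (add_edge T (a, b))"
  proof
    fix x assume "x \<in> set p"
    then have "{fst x, snd x} \<in> undirected_edges p"
      unfolding undirected_edges_def by (force simp: case_prod_beta)
    then have "{fst x, snd x} \<in> undirected_edges p0" by (simp only: p(2))
    then have "x \<in> set p0 \<or> (snd x, fst x) \<in> set p0"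
      by (auto simp: undirected_edges_def doubleton_eq_iff)
    then have "x \<in> parcs (add_edge T (a, b)) \<or> (snd x, fst x) \<in> parcs (add_edge T (a, b))"
      using p0 by (auto simp: oriented_cycle_iff[OF wf])
    then show "x \<in> parcs (add_edge T (a, b))"
      using T.arcs_symmetric by (cases x) (auto simp: add_edge_simps)
  qed
  then have "oriented_cycle (add_edge T (a, b)) p"
    using p(1) by (simp add: oriented_cycle_iff[OF G.pair_wf_digraph] oriented_cycle_iff[OF wf])
  then have "prod_list (map \<phi> p) \<in> {switched \<theta> \<phi> (a, b), switched \<theta> \<phi> (b, a)}"
    by (rule chord_cycle_gain[OF T.pair_wf_digraph acyclic_T c _ \<theta>])
  moreover have "switched \<theta> \<phi> (b, a) = cnj (switched \<theta> \<phi> (a, b))"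
  proof -
    have "inverse (\<theta> v) = cnj (\<theta> v)" if "v \<in> {a, b}" for v
      using unit[of v] that c by (auto simp: chord_def inverse_unit_cnj)
    then show ?thesis using gain_swap[of a b] e
      by (simp add: switched_def divide_inverse mult_ac)
  qed
  ultimately show ?thesis unfolding C Re_cycle_gain_def oriented_gain_def p_def[symmetric] by auto
qed

text \<open>A fundamental cycle contains its chord and otherwise only tree edges, so it determines
  the chord up to orientation.\<close>

lemma fundamental_cycle_eq_iff:
  assumes e: "e \<in> parcs G - parcs T" and e': "e' \<in> parcs G - parcs T"
  shows "fundamental_cycle T e = fundamental_cycle T e' \<longleftrightarrow> e' = e \<or> e' = prod.swap e"
proof
  assume eq: "fundamental_cycle T e = fundamental_cycle T e'"
  obtain a b where ab: "e = (a, b)" by (cases e)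
  obtain a' b' where ab': "e' = (a', b')" by (cases e')
  note c = chordI[OF e[unfolded ab]] and c' = chordI[OF e'[unfolded ab']]
  obtain p where p: "oriented_cycle (add_edge T (a, b)) p"
    using chord_cycle_exists[OF pair_graph_T connected_T c] by blast
  obtain p' where p': "oriented_cycle (add_edge T (a', b')) p'"
    using chord_cycle_exists[OF pair_graph_T connected_T c'] by blast
  have "undirected_edges p = undirected_edges p'"
    using eq fundamental_cycle_eq[OF pair_graph_T connected_T acyclic_T] c c' p p' ab ab' by metis
  moreover have "{a, b} \<in> undirected_edges p"
    using cycle_contains_chord[OF T.pair_wf_digraph acyclic_T c p]
    by (force simp: undirected_edges_def)
  ultimately have "(a, b) \<in> set p' \<or> (b, a) \<in> set p'"
    by (auto simp: undirected_edges_def doubleton_eq_iff)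
  then have "(a, b) \<in> parcs (add_edge T (a', b')) \<or> (b, a) \<in> parcs (add_edge T (a', b'))"
    using p' unfolding oriented_cycle_iff[OF add_edge_wf[OF T.pair_wf_digraph c']] by blast
  then show "e' = e \<or> e' = prod.swap e"
    using c ab ab' by (auto simp: add_edge_simps chord_def)
next
  assume "e' = e \<or> e' = prod.swap e"
  moreover have "add_edge T (prod.swap e) = add_edge T e"
    by (simp add: add_edge_def insert_commute)
  ultimately show "fundamental_cycle T e = fundamental_cycle T e'"
    by (auto simp: fundamental_cycle_def)
qed

text \<open>Each fibre of the map from non-tree arcs to fundamental cycles consists of the two
  orientations of one chord.\<close>

lemma sum_fundamental_cycles:
  fixes f :: "'a set set \<Rightarrow> real"
  shows "(\<Sum>e\<in>parcs G - parcs T. f (fundamental_cycle T e)) = 2 * (\<Sum>C\<in>fundamental_cycles G T. f C)"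
proof -
  let ?S = "parcs G - parcs T"
  have fin: "finite ?S" by simp
  have "(\<Sum>e | e \<in> ?S \<and> fundamental_cycle T e = C. f (fundamental_cycle T e)) = 2 * f C"
    if C: "C \<in> fundamental_cycle T ` ?S" for C
  proof -
    obtain e where e: "e \<in> ?S" "C = fundamental_cycle T e" using C by blast
    have "prod.swap e \<in> ?S" "prod.swap e \<noteq> e"
      using e(1) G.arcs_symmetric T.arcs_symmetric G.no_loops' by (cases e; auto)+
    moreover have "{e'. e' \<in> ?S \<and> fundamental_cycle T e' = C} = {e, prod.swap e}"
      using fundamental_cycle_eq_iff[OF e(1)] e calculation(1) by blast
    moreover have "fundamental_cycle T (prod.swap e) = C"
      using fundamental_cycle_eq_iff[OF e(1) calculation(1)] e(2) by simp
    ultimately show ?thesis using e(2) by simp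
  qed
  then show ?thesis
    unfolding fundamental_cycles_def sum_distrib_left
    by (subst sum.image_gen[OF fin, of _ "fundamental_cycle T"]) (rule sum.cong, auto)
qed

end

section \<open>The energy of a gain graph\<close>

lemma sum_nth_distinct:
  "distinct vs \<Longrightarrow> (\<Sum>i<length vs. f (vs ! i)) = sum f (set vs)"
  by (rule sum.reindex_bij_betw[OF bij_betw_nth]) auto

lemma gain_adj_mat_carrier: "gain_adj_mat G \<phi> vs \<in> carrier_mat (length vs) (length vs)"
  by (simp add: gain_adj_mat_def)

context gain_graph_spanning_tree
begin

lemma hermitian_gain_adj_mat: "hermitian (gain_adj_mat G \<phi> vs)"
  unfolding hermitian_def
proof (intro allI impI)
  fix i j assume "i < dim_row (gain_adj_mat G \<phi> vs)" "j < dim_row (gain_adj_mat G \<phi> vs)"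
  then have ij: "i < length vs" "j < length vs" by (simp_all add: gain_adj_mat_def)
  show "gain_adj_mat G \<phi> vs $$ (j, i) = cnj (gain_adj_mat G \<phi> vs $$ (i, j))"
  proof (cases "(vs ! i, vs ! j) \<in> parcs G")
    case True
    then have "(vs ! j, vs ! i) \<in> parcs G" by (rule G.arcs_symmetric)
    then show ?thesis using True ij gain_swap[OF True] by (simp add: gain_adj_mat_def)
  next
    case False
    then have "(vs ! j, vs ! i) \<notin> parcs G" using G.arcs_symmetric by blast
    then show ?thesis using False ij by (simp add: gain_adj_mat_def)
  qed
qed

lemma gain_adj_mat_diag: "i < length vs \<Longrightarrow> gain_adj_mat G \<phi> vs $$ (i, i) = 0"
  using G.no_loops' by (auto simp: gain_adj_mat_def)

text \<open>The vector carries conjugates so that the summand at \<open>(u, v)\<close> is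
  \<open>\<theta> u * \<phi> (u, v) * cnj (\<theta> v)\<close>; for unimodular values conjugation is
  inversion, which yields the switched gain.\<close>

lemma gain_adj_mat_quadratic_form:
  assumes vs: "distinct vs" "set vs = pverts G" and unit: "\<And>v. v \<in> pverts T \<Longrightarrow> cmod (\<theta> v) = 1"
  defines "x \<equiv> vec (length vs) (\<lambda>i. cnj (\<theta> (vs ! i)))"
  shows "(gain_adj_mat G \<phi> vs *\<^sub>v x) \<bullet>c x = (\<Sum>a\<in>parcs G. switched \<theta> \<phi> a)"
proof -
  let ?n = "length vs"
  \<comment> \<open>Extension by 0 lets the double sum over all vertex pairs collapse to a sum over
    arcs.\<close>
  define F where "F a = (if a \<in> parcs G then switched \<theta> \<phi> a else 0)" for a
  have entry: "gain_adj_mat G \<phi> vs $$ (i, j) * x $ j * cnj (x $ i) = F (vs ! i, vs ! j)"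
    if "i < ?n" "j < ?n" for i j
  proof -
    have "cmod (\<theta> (vs ! j)) = 1" using unit that vs(2) pverts_T by (metis nth_mem)
    then have "cnj (\<theta> (vs ! j)) = inverse (\<theta> (vs ! j))" by (simp add: inverse_unit_cnj)
    then show ?thesis
      using that by (simp add: gain_adj_mat_def x_def F_def switched_def divide_inverse)
  qed
  have "(gain_adj_mat G \<phi> vs *\<^sub>v x) \<bullet>c x =
      (\<Sum>i<?n. \<Sum>j<?n. gain_adj_mat G \<phi> vs $$ (i, j) * x $ j * cnj (x $ i))"
    using gain_adj_mat_carrier[of G \<phi> vs]
    by (simp add: scalar_prod_def atLeast0LessThan sum_distrib_right x_def)
  also have "\<dots> = (\<Sum>i<?n. \<Sum>j<?n. F (vs ! i, vs ! j))"
    by (intro sum.cong refl entry) auto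
  also have "\<dots> = (\<Sum>u\<in>set vs. \<Sum>v\<in>set vs. F (u, v))"
    by (simp add: sum_nth_distinct[OF vs(1), of "\<lambda>v. F (_, v)"]
        sum_nth_distinct[OF vs(1), of "\<lambda>u. \<Sum>v\<in>set vs. F (u, v)"])
  also have "\<dots> = (\<Sum>a\<in>set vs \<times> set vs. F a)"
    by (simp add: sum.cartesian_product case_prod_beta)
  also have "\<dots> = (\<Sum>a\<in>parcs G. F a)"
  proof (rule sum.mono_neutral_right)
    show "parcs G \<subseteq> set vs \<times> set vs" using vs(2) G.wellformed' by fastforce
  qed (simp_all add: F_def)
  also have "\<dots> = (\<Sum>a\<in>parcs G. switched \<theta> \<phi> a)" by (simp add: F_def)
  finally show ?thesis .
qed

lemma gain_energy_ge:
  assumes vs: "distinct vs" "set vs = pverts G"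
  shows "gain_energy G \<phi> vs \<ge>
    4 + 4 / real (card (pverts G)) * ((\<Sum>C\<in>fundamental_cycles G T. Re_cycle_gain G \<phi> C) - 1)"
proof -
  let ?n = "card (pverts G)" and ?A = "gain_adj_mat G \<phi> vs"
    and ?S = "\<Sum>C\<in>fundamental_cycles G T. Re_cycle_gain G \<phi> C"
  have len: "length vs = ?n" using vs distinct_card by metis
  \<comment> \<open>Connectedness includes that there is a vertex, which permits the final
    division.\<close>
  have n: "1 \<le> ?n"
    using connected_T by (auto simp: connected_def strongly_connected_def pverts_T Suc_le_eq card_gt_0_iff)
  obtain \<theta> where \<theta>: "potential T \<phi> \<theta>"
    and unit: "\<And>v. v \<in> pverts T \<Longrightarrow> cmod (\<theta> v) = 1"
  proof (rule potential_exists[OF pair_graph_T connected_T acyclic_T, of \<phi>])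
    show "\<phi> (u, v) * \<phi> (v, u) = 1" if "(u, v) \<in> parcs T" for u v
      using gain_mult_swap parcs_T that by blast
  next
    fix \<theta>
    assume "potential T \<phi> \<theta>"
      and "(\<And>a. a \<in> parcs T \<Longrightarrow> cmod (\<phi> a) = 1) \<Longrightarrow> (\<And>v. v \<in> pverts T \<Longrightarrow> cmod (\<theta> v) = 1)"
    then show thesis using that[of \<theta>] cmod_gain parcs_T by blast
  qed
  define x where "x = vec (length vs) (\<lambda>i. cnj (\<theta> (vs ! i)))"
  have "cmod (\<theta> (vs ! i)) = 1" if "i < length vs" for i
    using unit that vs(2) pverts_T by (metis nth_mem)
  \<comment> \<open>The test vector has unimodular entries, so its squared norm counts the
    vertices.\<close>
  then have "sqnorm x = (\<Sum>i<length vs. 1)"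
    unfolding sqnorm_def x_def by (intro sum.cong) simp_all
  then have norm: "sqnorm x = real ?n" by (simp add: len)
  have "2 * Re ((?A *\<^sub>v x) \<bullet>c x) \<le> gain_energy G \<phi> vs * sqnorm x"
    unfolding gain_energy_def
    by (rule sum_cmod_proots_ge[OF gain_adj_mat_carrier hermitian_gain_adj_mat])
      (simp_all add: gain_adj_mat_diag x_def)
  moreover have "Re ((?A *\<^sub>v x) \<bullet>c x) = (\<Sum>a\<in>parcs G. Re (switched \<theta> \<phi> a))"
    unfolding x_def by (simp add: gain_adj_mat_quadratic_form[of vs \<theta>, OF vs unit])
  \<comment> \<open>The form splits into tree arcs, contributing 1 each, and the other arcs, which
    give every fundamental cycle twice.\<close>
  moreover have "(\<Sum>a\<in>parcs G. Re (switched \<theta> \<phi> a)) =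
      (\<Sum>a\<in>parcs G - parcs T. Re (switched \<theta> \<phi> a)) + (\<Sum>a\<in>parcs T. Re (switched \<theta> \<phi> a))"
    using parcs_T by (intro sum.subset_diff) auto
  moreover have "(\<Sum>a\<in>parcs T. Re (switched \<theta> \<phi> a)) = real (card (parcs T))"
    using switched_tree_arc[OF \<theta> T.pair_wf_digraph] by simp
  moreover have "(\<Sum>a\<in>parcs G - parcs T. Re (switched \<theta> \<phi> a)) = 2 * ?S"
  proof -
    have "(\<Sum>a\<in>parcs G - parcs T. Re (switched \<theta> \<phi> a)) =
        (\<Sum>a\<in>parcs G - parcs T. Re_cycle_gain G \<phi> (fundamental_cycle T a))"
      using Re_cycle_gain_fundamental[OF _ \<theta> unit] by (intro sum.cong) auto
    then show ?thesis by (simp only: sum_fundamental_cycles)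
  qed
  ultimately have "2 * (2 * ?S + real (card (parcs T))) \<le> gain_energy G \<phi> vs * real ?n"
    by (simp only: norm)
  moreover have "2 * real ?n - 2 \<le> real (card (parcs T))"
  proof -
    have "real (2 * (?n - 1)) \<le> real (card (parcs T))"
      using card_parcs_connected_ge[OF pair_graph_T connected_T] by (simp only: pverts_T of_nat_le_iff)
    then show ?thesis using n by (simp add: of_nat_diff)
  qed
  ultimately have "2 * (2 * real ?n - 2 + 2 * ?S) \<le> gain_energy G \<phi> vs * real ?n"
    by argo
  then have "4 * real ?n + 4 * (?S - 1) \<le> gain_energy G \<phi> vs * real ?n"
    by simp
  moreover have "0 < real ?n" using n by simp
  moreover have "4 + 4 / N * s \<le> E" if "4 * N + 4 * s \<le> E * N" "0 < N" for N s E :: real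
    using that by (simp add: field_simps)
  ultimately show ?thesis by blast
qed

end

section \<open>Sharpness\<close>

definition complete_pair_graph :: "nat \<Rightarrow> nat pair_pre_digraph" where
  "complete_pair_graph n = \<lparr> pverts = {..<n}, parcs = {(i, j). i < n \<and> j < n \<and> i \<noteq> j} \<rparr>"

definition path_pair_graph :: "nat \<Rightarrow> nat pair_pre_digraph" where
  "path_pair_graph n = \<lparr> pverts = {..<n}, parcs = {(i, j). i < n \<and> j < n \<and> (j = Suc i \<or> i = Suc j)} \<rparr>"

lemma complete_pair_graph_simps:
  "pverts (complete_pair_graph n) = {..<n}"
  "(i, j) \<in> parcs (complete_pair_graph n) \<longleftrightarrow> i < n \<and> j < n \<and> i \<noteq> j"
  by (simp_all add: complete_pair_graph_def)

lemma path_pair_graph_simps: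
  "pverts (path_pair_graph n) = {..<n}"
  "(i, j) \<in> parcs (path_pair_graph n) \<longleftrightarrow> i < n \<and> j < n \<and> (j = Suc i \<or> i = Suc j)"
  by (simp_all add: path_pair_graph_def)

lemma pair_graphI:
  assumes "finite (pverts G)"
    and "\<And>u v. (u, v) \<in> parcs G \<Longrightarrow> u \<in> pverts G \<and> v \<in> pverts G \<and> u \<noteq> v \<and> (v, u) \<in> parcs G"
  shows "pair_graph G"
proof
  show "finite (parcs G)"
    by (rule finite_subset[of _ "pverts G \<times> pverts G"]) (use assms in auto)
  show "symmetric (with_proj G)" using assms(2) by (auto simp: symmetric_def sym_def)
qed (use assms in auto)

lemma pair_graph_complete: "pair_graph (complete_pair_graph n)"
  by (rule pair_graphI) (auto simp: complete_pair_graph_simps)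

lemma pair_graph_path: "pair_graph (path_pair_graph n)"
  by (rule pair_graphI) (auto simp: path_pair_graph_simps)

text \<open>The path from 0 to \<open>v\<close> visits precisely the numbers up to \<open>v\<close>,
  so the tree order contains the usual order.\<close>

lemma path_pair_graph_apath:
  assumes "v < n" "u \<le> v"
  shows "tree_le (path_pair_graph n) 0 u v"
proof -
  define p where "p = map (\<lambda>i. (i, Suc i)) [0..<v]"
  have pcas: "pcas 0 (map (\<lambda>i. (i, Suc i)) [0..<k]) k" for k
    by (induction k) (auto simp: pcas_append)
  have verts: "pawalk_verts 0 p = 0 # map Suc [0..<v]"
    using pawalk_verts_eq[OF pcas[of v]] by (simp add: p_def o_def)
  moreover have "distinct (0 # map Suc [0..<v])" by (simp add: distinct_map)
  moreover have "set p \<subseteq> parcs (path_pair_graph n)"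
    using assms by (auto simp: p_def path_pair_graph_simps)
  ultimately have "pre_digraph.apath (with_proj (path_pair_graph n)) 0 p v"
    using assms pcas[of v]
    by (simp add: pre_digraph.apath_def pre_digraph.awalk_def cas_with_proj_eq
        awalk_verts_with_proj_eq p_def path_pair_graph_simps)
  moreover have "u \<in> set (pawalk_verts 0 p)"
    using assms(2) by (cases u) (auto simp: verts)
  ultimately show ?thesis unfolding tree_le_def awalk_verts_with_proj_eq by blast
qed

lemma connected_if_reachable:
  assumes "pair_graph G" "r \<in> pverts G" "\<And>v. v \<in> pverts G \<Longrightarrow> r \<rightarrow>\<^sup>*\<^bsub>with_proj G\<^esub> v"
  shows "Digraph_Component.connected (with_proj G)"
proof -
  interpret pair_graph G by fact
  have "u \<rightarrow>\<^sup>*\<^bsub>with_proj G\<^esub> v" if "u \<in> pverts G" "v \<in> pverts G" for u v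
    using assms(3) that symmetric_reachable[OF sym_arcs] reachable_trans by blast
  then show ?thesis
    using assms(2) reachable_mk_symmetric_eq[OF sym_arcs]
    by (auto simp: connected_def strongly_connected_def)
qed

lemma connected_path:
  assumes "1 \<le> n"
  shows "Digraph_Component.connected (with_proj (path_pair_graph n))"
proof -
  interpret pair_graph "path_pair_graph n" by (rule pair_graph_path)
  show ?thesis
  proof (rule connected_if_reachable[of _ 0])
    fix v assume "v \<in> pverts (path_pair_graph n)"
    then have "tree_le (path_pair_graph n) 0 0 v"
      by (intro path_pair_graph_apath) (auto simp: path_pair_graph_simps)
    then show "0 \<rightarrow>\<^sup>*\<^bsub>with_proj (path_pair_graph n)\<^esub> v"
      unfolding tree_le_def reachable_apath by blast
  qed (use assms in \<open>auto simp: pair_graph_path path_pair_graph_simps\<close>)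
qed

lemma connected_complete:
  assumes "1 \<le> n"
  shows "Digraph_Component.connected (with_proj (complete_pair_graph n))"
proof -
  interpret pair_graph "complete_pair_graph n" by (rule pair_graph_complete)
  show ?thesis
  proof (rule connected_if_reachable[of _ 0])
    fix v assume v: "v \<in> pverts (complete_pair_graph n)"
    show "0 \<rightarrow>\<^sup>*\<^bsub>with_proj (complete_pair_graph n)\<^esub> v"
    proof (cases "v = 0")
      case False
      then have "(0, v) \<in> parcs (complete_pair_graph n)" using v by (simp add: complete_pair_graph_simps)
      then show ?thesis by (intro reachable_adjI) simp
    qed (use v in auto)
  qed (use assms in \<open>auto simp: pair_graph_complete complete_pair_graph_simps\<close>)
qed

text \<open>The largest vertex of a cycle in a path would have to be entered from and left to its
  predecessor.\<close>
lemma acyclic_path: "\<nexists>C. graph_cycle (path_pair_graph n) C"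
proof
  assume "\<exists>C. graph_cycle (path_pair_graph n) C"
  then obtain p where p: "oriented_cycle (path_pair_graph n) p" by (auto simp: graph_cycle_def)
  interpret pair_graph "path_pair_graph n" by (rule pair_graph_path)
  obtain u where u: "pcas u p u" "set p \<subseteq> parcs (path_pair_graph n)" "3 \<le> length p"
    using p by (auto simp: oriented_cycle_iff[OF pair_wf_digraph])
  have "mset (map fst p) = mset (map snd p)" using pcas_mset_verts[OF u(1)] by simp
  then have fs: "fst ` set p = snd ` set p" by (metis list.set_map mset_eq_setD)
  define M where "M = Max (snd ` set p)"
  have "p \<noteq> []" using u(3) by auto
  then have "M \<in> snd ` set p" unfolding M_def by (intro Max_in) auto
  \<comment> \<open>Heads and tails of a closed walk form the same set, so the maximal vertex is
    both entered and left.\<close>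
  then obtain x y where xy: "(x, M) \<in> set p" "(M, y) \<in> set p" using fs by (force simp: image_iff)
  have le: "k \<le> M" if "k \<in> snd ` set p" for k using that by (simp add: M_def)
  have "y \<in> snd ` set p" using imageI[OF xy(2), of snd] by simp
  moreover have "x \<in> snd ` set p" using imageI[OF xy(1), of fst] fs by simp
  ultimately have "x \<le> M" "y \<le> M" using le by blast+
  moreover have "(x, M) \<in> parcs (path_pair_graph n)" "(M, y) \<in> parcs (path_pair_graph n)"
    using xy u(2) by auto
  \<comment> \<open>The only neighbour of \<open>M\<close> not exceeding \<open>M\<close> is its
    predecessor.\<close>
  ultimately have "x = y" by (auto simp: path_pair_graph_simps)
  then show False using oriented_cycle_no_reversed_arc[OF pair_wf_digraph p] xy by blast
qed

text \<open>Rooted at the end 0, the path makes any two vertices comparable, so every edge of the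
  complete graph satisfies normality.\<close>

lemma normal_spanning_tree_path_complete:
  assumes "1 \<le> n"
  shows "normal_spanning_tree (path_pair_graph n) 0 (complete_pair_graph n)"
proof -
  interpret T: pair_graph "path_pair_graph n" by (rule pair_graph_path)
  interpret G: pair_graph "complete_pair_graph n" by (rule pair_graph_complete)
  have "parcs (path_pair_graph n) \<subseteq> parcs (complete_pair_graph n)"
    by (auto simp: complete_pair_graph_simps path_pair_graph_simps)
  then have "spanning (with_proj (path_pair_graph n)) (with_proj (complete_pair_graph n))"
    using T.wf_digraph_axioms G.wf_digraph_axioms
    by (simp add: spanning_def subgraph_def compatible_def complete_pair_graph_simps path_pair_graph_simps)
  moreover have "tree_le (path_pair_graph n) 0 u v \<or> tree_le (path_pair_graph n) 0 v u"
    if "(u, v) \<in> parcs (complete_pair_graph n)" for u v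
    using that path_pair_graph_apath[of v n u] path_pair_graph_apath[of u n v]
    by (cases u v rule: le_cases) (simp_all add: complete_pair_graph_simps)
  ultimately show ?thesis
    using assms pair_graph_path connected_path acyclic_path
    by (auto simp: normal_spanning_tree_def undirected_spanning_tree_def path_pair_graph_simps)
qed

section \<open>Arc counts and the energy of the complete graph\<close>

lemma card_parcs_complete: "card (parcs (complete_pair_graph n)) = n * n - n"
proof -
  have "parcs (complete_pair_graph n) = {..<n} \<times> {..<n} - (\<lambda>i. (i, i)) ` {..<n}"
    by (auto simp: complete_pair_graph_simps)
  also have "card \<dots> = n * n - n"
    by (subst card_Diff_subset) (auto simp: card_cartesian_product card_image inj_on_def)
  finally show ?thesis .
qed

lemma card_parcs_path: "card (parcs (path_pair_graph n)) = 2 * (n - 1)"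
proof -
  let ?A = "(\<lambda>i. (i, Suc i)) ` {..<n - 1}" and ?B = "(\<lambda>i. (Suc i, i)) ` {..<n - 1}"
  have "parcs (path_pair_graph n) = ?A \<union> ?B"
    by (auto simp: path_pair_graph_simps)
  also have "card \<dots> = card ?A + card ?B" by (rule card_Un_disjoint) auto
  also have "\<dots> = 2 * (n - 1)" by (simp add: card_image inj_on_def)
  finally show ?thesis .
qed

lemma sum_mset_cmod_affine:
  assumes "\<And>z. z \<in># R \<Longrightarrow> cmod z = \<alpha> * Re z + \<beta>"
  shows "(\<Sum>z\<in>#R. cmod z) = \<alpha> * Re (\<Sum>\<^sub># R) + \<beta> * real (size R)"
  using assms by (induction R) (auto simp: algebra_simps)

text \<open>Every eigenvalue is -1 or \<open>n - 1\<close>. Multiplicities are avoided: on these two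
  values the modulus is an affine function of the real part, so the energy follows from the trace 0
  and the number \<open>n\<close> of roots.\<close>

lemma gain_energy_complete:
  assumes n: "1 \<le> n"
  shows "gain_energy (complete_pair_graph n) (\<lambda>_. 1) [0..<n] = 2 * (real n - 1)"
proof -
  let ?A = "gain_adj_mat (complete_pair_graph n) (\<lambda>_. 1) [0..<n]"
  let ?R = "proots (char_poly ?A)"
  have A: "?A \<in> carrier_mat n n" using gain_adj_mat_carrier[of _ _ "[0..<n]"] by simp
  have Aij: "?A $$ (i, j) = (if i = j then 0 else 1)" if "i < n" "j < n" for i j
    using that by (simp add: gain_adj_mat_def complete_pair_graph_simps)
  have nz: "char_poly ?A \<noteq> 0" using degree_monic_char_poly[OF A] by force
  have ev: "z = -1 \<or> z = of_real (real n - 1)" if "z \<in># ?R" for z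
  proof -
    have "eigenvalue ?A z" using that nz eigenvalue_root_char_poly[OF A] by simp
    then obtain v where v: "v \<in> carrier_vec n" "v \<noteq> 0\<^sub>v n" "?A *\<^sub>v v = z \<cdot>\<^sub>v v"
      using A by (auto simp: eigenvalue_def eigenvector_def)
    define S where "S = (\<Sum>j<n. v $ j)"
    \<comment> \<open>Row \<open>i\<close> of the eigenvector equation adds up all entries of
      \<open>v\<close> except the \<open>i\<close>-th.\<close>
    have row: "S = (z + 1) * v $ i" if i: "i < n" for i
    proof -
      have "z * v $ i = (?A *\<^sub>v v) $ i" using v i by simp
      also have "\<dots> = (\<Sum>j<n. ?A $$ (i, j) * v $ j)"
        using A v(1) i by (simp add: scalar_prod_def atLeast0LessThan)
      also have "\<dots> = (\<Sum>j<n. v $ j - (if i = j then v $ j else 0))"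
        using i by (intro sum.cong) (auto simp: Aij)
      also have "\<dots> = S - v $ i" using i by (simp add: sum_subtractf S_def)
      finally show ?thesis by (simp add: algebra_simps)
    qed
    show ?thesis
    \<comment> \<open>If the entries sum to 0, a nonzero entry forces -1; otherwise summing the row
      equations and cancelling \<open>S\<close> gives \<open>n - 1\<close>.\<close>
    proof (cases "S = 0")
      case True
      obtain i where "i < n" "v $ i \<noteq> 0" using v(1,2) by (metis carrier_vecD eq_vecI index_zero_vec)
      then have "z + 1 = 0" using row[of i] True by simp
      then show ?thesis by (simp add: add_eq_0_iff2)
    next
      case False
      have "of_nat n * S = (\<Sum>i<n. S)" by simp
      also have "\<dots> = (\<Sum>i<n. (z + 1) * v $ i)" by (intro sum.cong row) auto
      also have "\<dots> = (z + 1) * S" by (simp add: S_def sum_distrib_left)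
      finally have "of_nat n = z + 1" using False by simp
      then show ?thesis by (simp add: algebra_simps)
    qed
  qed
  \<comment> \<open>The slope of the line through the points \<open>(-1, 1)\<close> and
    \<open>(n - 1, n - 1)\<close>; its intercept is \<open>1 + \<alpha>\<close>.\<close>
  define \<alpha> where "\<alpha> = (real n - 2) / real n"
  have \<alpha>: "\<alpha> * real n = real n - 2" using n by (simp add: \<alpha>_def)
  have "cmod z = \<alpha> * Re z + (1 + \<alpha>)" if "z \<in># ?R" for z
    using ev[OF that]
  proof
    assume "z = of_real (real n - 1)"
    then have z: "cmod z = real n - 1" "Re z = real n - 1"
      using norm_of_real[of "real n - 1", where 'a = complex] n by simp_all
    show ?thesis unfolding z using \<alpha> by (simp add: algebra_simps)
  qed simp
  then have "(\<Sum>z\<in>#?R. cmod z) = \<alpha> * Re (\<Sum>\<^sub># ?R) + (1 + \<alpha>) * real (size ?R)"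
    by (rule sum_mset_cmod_affine)
  moreover have "\<Sum>\<^sub># ?R = 0" using sum_proots_char_poly[OF A] Aij by simp
  moreover have "size ?R = n" using degree_monic_char_poly[OF A] by (simp add: size_proots_complex)
  ultimately show ?thesis using \<alpha> by (simp add: gain_energy_def algebra_simps)
qed

lemma gain_graph_complete: "gain_graph (complete_pair_graph n) (\<lambda>_. 1)"
  using pair_graph_complete by (simp add: gain_graph_def)

text \<open>With all gains 1 the cycle sum counts the \<open>(n - 1) * (n - 2) / 2\<close>
  fundamental cycles, which makes the bound equal to \<open>2 * (n - 1)\<close>.\<close>

lemma gain_energy_complete_eq:
  assumes n: "1 \<le> n"
  defines "G \<equiv> complete_pair_graph n" and "T \<equiv> path_pair_graph n"
  shows "gain_energy G (\<lambda>_. 1) [0..<n] =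
    4 + 4 / real n * ((\<Sum>C\<in>fundamental_cycles G T. Re_cycle_gain G (\<lambda>_. 1) C) - 1)"
proof -
  have tree: "undirected_spanning_tree T G"
    using normal_spanning_tree_path_complete[OF n] by (simp add: normal_spanning_tree_def G_def T_def)
  interpret gain_graph_spanning_tree G "\<lambda>_. 1" T
    by unfold_locales (use tree gain_graph_complete in \<open>auto simp: G_def\<close>)
  \<comment> \<open>Every arc list has gain 1, so the choice of the list tracing a cycle does not
    matter.\<close>
  have "oriented_gain (\<lambda>_. 1) p = 1" for p :: "(nat \<times> nat) list"
    by (induction p) (simp_all add: oriented_gain_def)
  then have "Re_cycle_gain G (\<lambda>_. 1) C = 1" for C by (simp add: Re_cycle_gain_def)
  then have "2 * (\<Sum>C\<in>fundamental_cycles G T. Re_cycle_gain G (\<lambda>_. 1) C) = real (card (parcs G - parcs T))"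
    using sum_fundamental_cycles[of "\<lambda>_. 1"] by simp
  moreover have "card (parcs G - parcs T) = card (parcs G) - card (parcs T)"
    using parcs_T by (intro card_Diff_subset) auto
  moreover have "card (parcs T) \<le> card (parcs G)" using parcs_T by (intro card_mono) auto
  ultimately have "2 * (\<Sum>C\<in>fundamental_cycles G T. Re_cycle_gain G (\<lambda>_. 1) C) =
      real (card (parcs G)) - real (card (parcs T))"
    by (simp add: of_nat_diff)
  also have "real (card (parcs G)) = real n * real n - real n"
    by (simp add: G_def card_parcs_complete of_nat_diff)
  also have "real (card (parcs T)) = 2 * (real n - 1)"
    using n by (simp add: T_def card_parcs_path of_nat_diff)
  finally have "2 * (\<Sum>C\<in>fundamental_cycles G T. Re_cycle_gain G (\<lambda>_. 1) C) =
      real n * real n - real n - 2 * (real n - 1)" .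
  then have "4 * ((\<Sum>C\<in>fundamental_cycles G T. Re_cycle_gain G (\<lambda>_. 1) C) - 1) = (2 * real n - 6) * real n"
    by (simp add: algebra_simps)
  then have "4 / real n * ((\<Sum>C\<in>fundamental_cycles G T. Re_cycle_gain G (\<lambda>_. 1) C) - 1) = 2 * real n - 6"
    using n by (simp add: field_simps)
  then show ?thesis using gain_energy_complete[OF n] by (simp add: G_def)
qed

theorem theorem4p5:
  shows "(\<forall>(G :: 'a pair_pre_digraph) \<phi> T r vs n.
            gain_graph G \<phi> \<and> Digraph_Component.connected (with_proj G) \<and>
            distinct vs \<and> set vs = pverts G \<and> n = card (pverts G) \<and>
            normal_spanning_tree T r G
            \<longrightarrow> gain_energy G \<phi> vs
                  \<ge> 4 + 4 / real n * ((\<Sum>C\<in>fundamental_cycles G T. Re_cycle_gain G \<phi> C) - 1))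
         \<and>
         (\<forall>n \<ge> 1. \<exists>(G :: nat pair_pre_digraph) \<phi> T r vs.
            gain_graph G \<phi> \<and> Digraph_Component.connected (with_proj G) \<and>
            distinct vs \<and> set vs = pverts G \<and> n = card (pverts G) \<and>
            normal_spanning_tree T r G
            \<and> gain_energy G \<phi> vs
                  = 4 + 4 / real n * ((\<Sum>C\<in>fundamental_cycles G T. Re_cycle_gain G \<phi> C) - 1))"
proof (intro conjI allI impI)
  fix G :: "'a pair_pre_digraph" and \<phi> T r vs n
  assume *: "gain_graph G \<phi> \<and> Digraph_Component.connected (with_proj G) \<and>
    distinct vs \<and> set vs = pverts G \<and> n = card (pverts G) \<and> normal_spanning_tree T r G"
  then interpret gain_graph_spanning_tree G \<phi> T
    by unfold_locales (auto simp: normal_spanning_tree_def)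
  show "gain_energy G \<phi> vs
      \<ge> 4 + 4 / real n * ((\<Sum>C\<in>fundamental_cycles G T. Re_cycle_gain G \<phi> C) - 1)"
    using gain_energy_ge[of vs] * by simp
next
  fix n :: nat
  assume n: "1 \<le> n"
  show "\<exists>(G :: nat pair_pre_digraph) \<phi> T r vs.
      gain_graph G \<phi> \<and> Digraph_Component.connected (with_proj G) \<and>
      distinct vs \<and> set vs = pverts G \<and> n = card (pverts G) \<and> normal_spanning_tree T r G
      \<and> gain_energy G \<phi> vs
        = 4 + 4 / real n * ((\<Sum>C\<in>fundamental_cycles G T. Re_cycle_gain G \<phi> C) - 1)"
    using gain_energy_complete_eq[OF n] gain_graph_complete connected_complete[OF n]
      normal_spanning_tree_path_complete[OF n]
    by (intro exI[of _ "complete_pair_graph n"] exI[of _ "\<lambda>_. 1"] exI[of _ "path_pair_graph n"]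
        exI[of _ "0 :: nat"] exI[of _ "[0..<n]"])
      (auto simp: complete_pair_graph_simps)
qed

end
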